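(* Let $C \subseteq \mathbb{R}^d$ be an open convex cone and let $\Omega_C = \mathbb{R}^d + iC \subseteq \mathbb{C}^d$ be the corresponding tube domain. Let $p \in \mathbb{C}[z_1,\ldots,z_d]$, $p \neq 0$, and write $p = r + iq$ with $r,q \in \mathbb{R}[z_1,\ldots,z_d]$. Let $n = \deg p$ and, for $0 \le j \le n$, let $p_j$, $r_j$, $q_j$ denote the homogeneous components of degree $j$ of $p$, $r$, $q$ respectively. 1. The following are equivalent: (i) $p$ is $\Omega_C$-stable, i.e., $p(z) \neq 0$ for all $z \in \Omega_C$. (ii) For all $y \in C$ and all $x \in \mathbb{R}^d$, the polynomial $p(x+ty) \in \mathbb{C}[t]$ is Hurwitz stable, i.e., it has no zeroes in the upper half plane $\mathbb{H}$. (iii) For all $y \in C$ and all $x \in \mathbb{R}^d$, the polynomials $r(x+ty), q(x+ty) \in \mathbb{R}[t]$ are real Hurwitz stable, i.e., all their zeroes are real, and their zeroes interlace. (iv) The real rational function $r/q$ satisfies $\operatorname{Im}\,(r/q)(z) > 0$ for all $z \in \Omega_C$. 2. Assume that $p$ is $\Omega_C$-stable. Then there exists $c \in \mathbb{C}$, $c \neq 0$, such that $cp_n \in \mathbb{R}[z_1,\ldots,z_d]$ and $cp_n$ is a hyperbolic polynomial with $C$ contained in the closure of a union of hyperbolicity cones of $cp_n$. (We say that $p$ is normalized if $p_n \in \mathbb{R}[z_1,\ldots,z_d]$.) 3. Assume that $p$ is a normalized $\Omega_C$-stable polynomial. Then $q_{n-1}$ is a hyperbolic polynomial such that for every $x \in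 \mathbb{R}^d$ and $y \in C$ the zeroes of $p_n(x+ty)$ and $q_{n-1}(x+ty) \in \mathbb{R}[t]$ are all real and interlace.
   Context: $\mathbb{H} = \{z \in \mathbb{C} : \operatorname{Im} z > 0\}$ is the open upper half plane. A homogeneous polynomial $h \in \mathbb{R}[z_1,\ldots,z_d]$ is called hyperbolic with respect to $a \in \mathbb{R}^d$ if $h(a)\neq 0$ and, for every $b \in \mathbb{R}^d$, the one-variable polynomial $t\mapsto h(ta-b)$ has only real roots; it is called hyperbolic if it is hyperbolic with respect to some $a$. If $h$ is hyperbolic with respect to $a$, the connected component of $a$ in $\mathbb{R}^d \setminus \{x \in \mathbb{R}^d : h(x)=0\}$ is a convex cone, called a hyperbolicity cone of $h$ (different choices of $a$ may give different hyperbolicity cones). Interlacing of the zeroes of two real-rooted polynomials in $\mathbb{R}[t]$ is meant in the usual sense: the zeroes of the two polynomials, counted with multiplicity, alternate along the real line (weakly, so that common zeroes are allowed).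
   Formalization: C is nonempty; (iii) also requires r'q − rq' ≥ 0 on each line x+ty, and the zero polynomial counts as real Hurwitz stable and interlaces nonzero ones; (iv) includes q(z) ≠ 0 on Ω_C; (i)⇒(iv) assumes q ≠ 0 and r/q not a real constant; Part 3 assumes q ≠ 0. *)

theory Defs
  imports
    "HOL-Analysis.Analysis"
    "HOL-Library.Poly_Mapping"
    "HOL-Computational_Algebra.Polynomial"
begin

text \<open>
  A polynomial over \<open>'a\<close> in the variables \<open>z\<^sub>i\<close>, \<open>i :: 'd\<close>, is a finitely supported map from
  exponent vectors to coefficients; with \<open>'d\<close> finite, the number of variables is \<open>CARD('d)\<close>.
\<close>

type_synonym ('a, 'd) mpoly = "('d \<Rightarrow>\<^sub>0 nat) \<Rightarrow>\<^sub>0 'a"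

definition mpoly_const :: "'a::zero \<Rightarrow> ('a, 'd) mpoly" where
  "mpoly_const c = Poly_Mapping.single 0 c"

definition mpoly_eval :: "('a::comm_semiring_1, 'd::finite) mpoly \<Rightarrow> 'a ^ 'd \<Rightarrow> 'a" where
  "mpoly_eval p z =
     (\<Sum>m\<in>Poly_Mapping.keys p. Poly_Mapping.lookup p m * (\<Prod>i\<in>UNIV. (z $ i) ^ Poly_Mapping.lookup m i))"

text \<open>The univariate polynomial \<open>p(x + t y)\<close> in the variable \<open>t\<close>.\<close>

definition mpoly_line ::
    "('a::comm_semiring_1, 'd::finite) mpoly \<Rightarrow> 'a ^ 'd \<Rightarrow> 'a ^ 'd \<Rightarrow> 'a poly" where
  "mpoly_line p x y =
     (\<Sum>m\<in>Poly_Mapping.keys p. [:Poly_Mapping.lookup p m:] *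
        (\<Prod>i\<in>UNIV. [:x $ i, y $ i:] ^ Poly_Mapping.lookup m i))"

definition monom_degree :: "('d::finite \<Rightarrow>\<^sub>0 nat) \<Rightarrow> nat" where
  "monom_degree m = (\<Sum>i\<in>UNIV. Poly_Mapping.lookup m i)"

text \<open>The zero polynomial gets degree 0.\<close>

definition total_degree :: "('a::zero, 'd::finite) mpoly \<Rightarrow> nat" where
  "total_degree p = Max (insert 0 (monom_degree ` Poly_Mapping.keys p))"

definition hom_component :: "nat \<Rightarrow> ('a::comm_monoid_add, 'd::finite) mpoly \<Rightarrow> ('a, 'd) mpoly" where
  "hom_component j p =
     (\<Sum>m\<in>{m \<in> Poly_Mapping.keys p. monom_degree m = j}.
        Poly_Mapping.single m (Poly_Mapping.lookup p m))"

definition homogeneous :: "('a::zero, 'd::finite) mpoly \<Rightarrow> bool" where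
  "homogeneous p \<longleftrightarrow> (\<exists>k. \<forall>m\<in>Poly_Mapping.keys p. monom_degree m = k)"

definition cmpoly :: "(real, 'd) mpoly \<Rightarrow> (complex, 'd) mpoly" where
  "cmpoly p = Poly_Mapping.map complex_of_real p"

definition cvec :: "real ^ 'd \<Rightarrow> complex ^ 'd" where
  "cvec x = (\<chi> i. complex_of_real (x $ i))"

text \<open>
  The predicate \<open>cone\<close> of the library is closed under multiplication by 0, so that an open set
  satisfying it is empty or the whole space; here only positive multiples are taken.
\<close>

definition open_convex_cone :: "'v::real_normed_vector set \<Rightarrow> bool" where
  "open_convex_cone C \<longleftrightarrow>
     C \<noteq> {} \<and> open C \<and> convex C \<and> (\<forall>x\<in>C. \<forall>c>0. c *\<^sub>R x \<in> C)"

definition tube :: "(real ^ 'd::finite) set \<Rightarrow> (complex ^ 'd) set" where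
  "tube C = {cvec x + \<i> *s cvec y | x y. y \<in> C}"

definition stable_on :: "(complex ^ 'd::finite) set \<Rightarrow> (complex, 'd) mpoly \<Rightarrow> bool" where
  "stable_on \<Omega> p \<longleftrightarrow> (\<forall>z\<in>\<Omega>. mpoly_eval p z \<noteq> 0)"

definition hurwitz_stable :: "complex poly \<Rightarrow> bool" where
  "hurwitz_stable f \<longleftrightarrow> (\<forall>t. Im t > 0 \<longrightarrow> poly f t \<noteq> 0)"

text \<open>
  All zeroes in the complex plane are real. The zero polynomial does not have this property.
\<close>

definition real_rooted :: "real poly \<Rightarrow> bool" where
  "real_rooted f \<longleftrightarrow> (\<forall>t::complex. poly (map_poly complex_of_real f) t = 0 \<longrightarrow> t \<in> \<real>)"

text \<open>By convention the zero polynomial is real Hurwitz stable.\<close>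

definition real_hurwitz_stable :: "real poly \<Rightarrow> bool" where
  "real_hurwitz_stable f \<longleftrightarrow> f = 0 \<or> real_rooted f"

text \<open>
  For nondecreasing lists: \<open>a\<^sub>1 \<le> b\<^sub>1 \<le> a\<^sub>2 \<le> b\<^sub>2 \<le> \<dots>\<close>, where \<open>as\<close> is as long as \<open>bs\<close> or longer by one.
\<close>

definition alternating :: "real list \<Rightarrow> real list \<Rightarrow> bool" where
  "alternating as bs \<longleftrightarrow>
     (length as = length bs \<or> length as = length bs + 1) \<and>
     (\<forall>i<length bs. as ! i \<le> bs ! i) \<and>
     (\<forall>i. i + 1 < length as \<longrightarrow> bs ! i \<le> as ! (i + 1))"

definition real_zeroes :: "real poly \<Rightarrow> real list" where
  "real_zeroes f = sorted_list_of_multiset (proots f)"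

text \<open>
  To be used for polynomials all of whose zeroes are real. By convention the zero polynomial
  interlaces every nonzero polynomial, but not itself.
\<close>

definition interlacing :: "real poly \<Rightarrow> real poly \<Rightarrow> bool" where
  "interlacing f g \<longleftrightarrow>
     (f \<noteq> 0 \<or> g \<noteq> 0) \<and>
     (f \<noteq> 0 \<and> g \<noteq> 0 \<longrightarrow>
        alternating (real_zeroes f) (real_zeroes g) \<or> alternating (real_zeroes g) (real_zeroes f))"

text \<open>
  Interlacing is symmetric in \<open>f\<close> and \<open>g\<close> and insensitive to signs, so it cannot distinguish
  \<open>f + \<i> g\<close> from \<open>f - \<i> g\<close>. The orientation of an interlacing pair is fixed by the sign of the
  Wronskian: the condition says that \<open>f / g\<close> is nondecreasing between its poles, as for
  \<open>f = t\<close>, \<open>g = 1\<close>, where \<open>t + \<i>\<close> has its zero in the lower half plane.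
\<close>

definition positively_oriented :: "real poly \<Rightarrow> real poly \<Rightarrow> bool" where
  "positively_oriented f g \<longleftrightarrow> (\<forall>t. poly (pderiv f * g - f * pderiv g) t \<ge> 0)"

definition hyperbolic_wrt :: "(real, 'd::finite) mpoly \<Rightarrow> real ^ 'd \<Rightarrow> bool" where
  "hyperbolic_wrt h a \<longleftrightarrow>
     homogeneous h \<and> mpoly_eval h a \<noteq> 0 \<and> (\<forall>b. real_rooted (mpoly_line h (- b) a))"

definition hyperbolic :: "(real, 'd::finite) mpoly \<Rightarrow> bool" where
  "hyperbolic h \<longleftrightarrow> (\<exists>a. hyperbolic_wrt h a)"

definition hyperbolicity_cone :: "(real, 'd::finite) mpoly \<Rightarrow> (real ^ 'd) set \<Rightarrow> bool" where
  "hyperbolicity_cone h K \<longleftrightarrow>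
     (\<exists>a. hyperbolic_wrt h a \<and> K = connected_component_set {x. mpoly_eval h x \<noteq> 0} a)"

end

theory Submission
  imports
    Defs
    "HOL-Computational_Algebra.Fundamental_Theorem_Algebra"
    "HOL-Computational_Algebra.Polynomial_Factorial"
    "HOL-Computational_Algebra.Field_as_Ring"
begin

text \<open>
  Everything happens on the lines \<open>x + t y\<close> with \<open>y \<in> C\<close>: the points with \<open>Im t > 0\<close> on them are
  exactly the points of the tube. So \<open>p\<close> is stable if and only if each univariate polynomial
  \<open>f + \<i> g\<close> with \<open>f = r(x + t y)\<close> and \<open>g = q(x + t y)\<close> has no zeros in the upper half plane, and the
  equivalence with real-rootedness and interlacing is the Hermite--Biehler theorem
  (\<open>hermite_biehler\<close>) on each line.

  In one direction, a stable \<open>f + \<i> g\<close> has Wronskian \<open>f' g - f g' \<ge> 0\<close>, because the logarithmic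
  derivative of \<open>f + \<i> g\<close> is a sum of terms \<open>1 / (t - w)\<close> with \<open>Im w \<le> 0\<close>. Once common roots are divided
  out, the inequality is strict, \<open>f / g\<close> increases between its poles, and by Rolle's argument the roots of
  each polynomial separate those of the other. In the other direction, interlacing confines \<open>f / g\<close> on the
  upper half plane to one of the two closed half planes (\<open>alternating_prod_quotient\<close>); the sign of the
  Wronskian tells which.

  All other statements pass to limits of stable polynomials. The limit argument rests on an
  elementary bound (\<open>norm_le_of_root_free_disc\<close>): a polynomial of degree at most \<open>N\<close> without zeros in
  a disc of radius \<open>\<rho>\<close> around \<open>s\<^sub>0\<close> is at most \<open>(1 + \<bar>s - s\<^sub>0\<bar> / \<rho>)\<^sup>N\<close> times as large at \<open>s\<close> as at \<open>s\<^sub>0\<close>.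
  Hence a limit of such polynomials that vanishes at \<open>s\<^sub>0\<close> vanishes everywhere, and on complex lines the
  same holds in several variables (\<open>limit_nonvanishing\<close>). Stability of \<open>r + \<i> q\<close> implies that of
  \<open>r + \<i> \<mu> q\<close> for every \<open>\<mu> > 0\<close>, since \<open>Im (r / q) \<ge> 0\<close> on the tube. The limits used are these.

  \<^item> As \<open>\<mu>\<close> tends to 0, \<open>r\<close> and in the same way every real combination of \<open>r\<close> and \<open>q\<close> is stable or
    zero (\<open>stable_pencil\<close>); so \<open>r / q\<close> takes no real value on the tube unless it is constant.
  \<^item> The polynomials \<open>p(k z) / k\<^sup>n\<close> tend to \<open>p\<^sub>n\<close>, which is therefore stable. Being homogeneous, it is
    stable with respect to \<open>- C\<close> as well, so on every line all its roots are real; then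
    \<open>p\<^sub>n(x) / p\<^sub>n(y)\<close> is real for all real \<open>x\<close> and all \<open>y \<in> C\<close>, and every \<open>y \<in> C\<close> is a hyperbolic direction.
  \<^item> If \<open>p\<^sub>n\<close> is real, then \<open>(r(k z) + \<i> k q(k z)) / k\<^sup>n\<close> tends to \<open>p\<^sub>n + \<i> q\<^sub>n\<^sub>-\<^sub>1\<close>, which is therefore
    stable, and the Hermite--Biehler theorem applies to this pair.
\<close>

section \<open>Real polynomials at complex points\<close>

abbreviation cpoly :: "real poly \<Rightarrow> complex poly" where
  "cpoly \<equiv> map_poly complex_of_real"

lemma cpoly_add: "cpoly (f + g) = cpoly f + cpoly g"
  by (rule poly_eqI) (simp add: coeff_map_poly)

lemma cpoly_minus: "cpoly (- f) = - cpoly f"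
  by (rule poly_eqI) (simp add: coeff_map_poly)

lemma cpoly_smult: "cpoly (smult c f) = smult (of_real c) (cpoly f)"
  by (rule poly_eqI) (simp add: coeff_map_poly)

lemma cpoly_mult: "cpoly (f * g) = cpoly f * cpoly g"
  by (rule poly_eqI) (simp add: coeff_map_poly coeff_mult)

lemma cpoly_eq_0_iff [simp]: "cpoly f = 0 \<longleftrightarrow> f = 0"
  by (rule map_poly_eq_0_iff) auto

lemma poly_cpoly_of_real: "poly (cpoly f) (of_real x) = of_real (poly f x)"
  by (induction f) (auto simp: map_poly_pCons)

lemma poly_cpoly_cnj: "poly (cpoly f) (cnj t) = cnj (poly (cpoly f) t)"
  by (induction f) (auto simp: map_poly_pCons)

lemma pderiv_cpoly: "pderiv (cpoly f) = cpoly (pderiv f)"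
  by (rule poly_eqI) (simp add: coeff_map_poly coeff_pderiv)

lemma complex_poly_root_induct [case_names const root]:
  assumes "\<And>c. S [:c:]" and "\<And>w P. S P \<Longrightarrow> P \<noteq> 0 \<Longrightarrow> S ([:-w, 1:] * P)"
  shows "S (P :: complex poly)"
proof (induction "degree P" arbitrary: P)
  case 0
  then show ?case using assms(1) by (metis degree_eq_zeroE)
next
  case (Suc k)
  then obtain w where "poly P w = 0"
    using alg_closed_imp_poly_has_root[of P] by auto
  then obtain Q where Q: "P = [:-w, 1:] * Q" by (auto simp: poly_eq_0_iff_dvd)
  have "Q \<noteq> 0" using Q Suc.hyps(2) by auto
  then have "degree P = Suc (degree Q)" unfolding Q by (subst degree_mult_eq) auto
  then show ?case using Suc assms(2)[of Q w] \<open>Q \<noteq> 0\<close> Q by simp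
qed

section \<open>Limits of polynomials without roots in a disc\<close>

text \<open>
  Each root \<open>w\<close> lies at distance at least \<open>\<rho>\<close> from \<open>s0\<close>, so its linear factor satisfies
  \<open>\<bar>s - w\<bar> \<le> (1 + \<bar>s - s0\<bar> / \<rho>) \<bar>s0 - w\<bar>\<close>; the bound is the product of these inequalities. Its
  constant depends only on the degree, which is what makes it survive a limit.
\<close>

lemma norm_le_of_root_free_disc:
  fixes P :: "complex poly"
  assumes "\<And>s. dist s0 s < \<rho> \<Longrightarrow> poly P s \<noteq> 0" "\<rho> > 0" "degree P \<le> N"
  shows "norm (poly P s) \<le> (1 + dist s0 s / \<rho>) ^ N * norm (poly P s0)"
proof -
  let ?K = "1 + dist s0 s / \<rho>"
  have K: "?K \<ge> 1" using assms(2) by simp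
  have "norm (poly P s) \<le> ?K ^ degree P * norm (poly P s0)"
    using assms(1)
  proof (induction P rule: complex_poly_root_induct)
    case (const c)
    then show ?case by simp
  next
    case (root w P)
    have w: "dist s0 w \<ge> \<rho>" using root.prems[of w] by (force simp: not_less)
    have IH: "norm (poly P s) \<le> ?K ^ degree P * norm (poly P s0)"
      using root.prems by (intro root.IH) auto
    have "norm (s - w) \<le> dist s0 s + dist s0 w"
      using dist_triangle3[of s w s0] by (simp add: dist_norm)
    also have "\<dots> \<le> dist s0 s * (dist s0 w / \<rho>) + dist s0 w"
      using w assms(2) mult_left_mono[of 1 "dist s0 w / \<rho>" "dist s0 s"] by simp
    also have "\<dots> = ?K * norm (s0 - w)"
      by (simp add: dist_norm algebra_simps)
    finally have 1: "norm (s - w) \<le> ?K * norm (s0 - w)" .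
    have "norm (poly ([:-w, 1:] * P) s) = norm (s - w) * norm (poly P s)"
      by (simp add: norm_mult[symmetric] algebra_simps)
    also have "\<dots> \<le> (?K * norm (s0 - w)) * (?K ^ degree P * norm (poly P s0))"
      using K by (intro mult_mono 1 IH) auto
    also have "\<dots> = ?K ^ Suc (degree P) * norm ((s0 - w) * poly P s0)"
      by (simp add: norm_mult)
    also have "Suc (degree P) = degree ([:-w, 1:] * P)"
      using root.hyps by (subst degree_mult_eq) auto
    also have "(s0 - w) * poly P s0 = poly ([:-w, 1:] * P) s0"
      by (simp add: algebra_simps)
    finally show ?case .
  qed
  also have "\<dots> \<le> ?K ^ N * norm (poly P s0)"
    using K assms(3) by (intro mult_right_mono power_increasing) auto
  finally show ?thesis .
qed

text \<open>
  A form of Hurwitz's theorem that needs pointwise convergence only: by the preceding bound, a zero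
  of the limit at the centre of the disc propagates to every other point.
\<close>

lemma limit_of_root_free_eq_0:
  fixes F :: "nat \<Rightarrow> complex poly"
  assumes "\<And>k. degree (F k) \<le> N" "\<And>k s. dist s0 s < \<rho> \<Longrightarrow> poly (F k) s \<noteq> 0" "\<rho> > 0"
    and lim: "\<And>s. (\<lambda>k. poly (F k) s) \<longlonglongrightarrow> L s" and "L s0 = 0"
  shows "L s = 0"
proof -
  have "norm (L s) \<le> (1 + dist s0 s / \<rho>) ^ N * norm (L s0)"
  proof (rule LIMSEQ_le[OF tendsto_norm[OF lim[of s]] tendsto_mult_left[OF tendsto_norm[OF lim[of s0]]]])
    show "\<exists>M. \<forall>k\<ge>M. norm (poly (F k) s) \<le> (1 + dist s0 s / \<rho>) ^ N * norm (poly (F k) s0)"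
      using norm_le_of_root_free_disc[OF assms(2) assms(3) assms(1)] by blast
  qed
  then show ?thesis using \<open>L s0 = 0\<close> by simp
qed

section \<open>Stable pairs and the Wronskian\<close>

lemma hurwitz_stable_root_factor:
  "hurwitz_stable ([:-w, 1:] * P) \<longleftrightarrow> Im w \<le> 0 \<and> hurwitz_stable P"
proof -
  have "Im w \<le> 0 \<longleftrightarrow> (\<forall>t. Im t > 0 \<longrightarrow> t \<noteq> w)"
    using not_less by blast
  then show ?thesis by (auto simp: hurwitz_stable_def)
qed

text \<open>
  A root in the closed lower half plane is at least as close to \<open>cnj t\<close> as to \<open>t\<close>.
\<close>

lemma norm_reflected_le:
  assumes "hurwitz_stable P" "Im t \<ge> 0"
  shows "norm (poly P (cnj t)) \<le> norm (poly P t)"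
  using assms(1)
proof (induction P rule: complex_poly_root_induct)
  case (const c)
  then show ?case by simp
next
  case (root w P)
  have w: "Im w \<le> 0" and "hurwitz_stable P"
    using root.prems by (simp_all only: hurwitz_stable_root_factor)
  have "- (Im t * Im w) \<ge> 0" using w assms(2) by (simp add: mult_nonneg_nonpos)
  then have "(Im (cnj t - w))\<^sup>2 \<le> (Im (t - w))\<^sup>2"
    by (simp add: power2_eq_square algebra_simps)
  then have 1: "norm (cnj t - w) \<le> norm (t - w)" by (simp add: cmod_def)
  have "norm ((cnj t - w) * poly P (cnj t)) \<le> norm ((t - w) * poly P t)"
    unfolding norm_mult using 1 root.IH \<open>hurwitz_stable P\<close> by (intro mult_mono) auto
  then show ?case by (simp add: algebra_simps)
qed

text \<open>
  Where \<open>P\<close> does not vanish, \<open>P' cnj P = \<bar>P\<bar>\<^sup>2 P' / P\<close>, and the logarithmic derivative is the sum of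
  \<open>1 / (x - w)\<close> over the roots \<open>w\<close>, with imaginary part \<open>Im w / \<bar>x - w\<bar>\<^sup>2\<close>. Only a root off the real
  axis contributes strictly. Splitting off one root at a time avoids the division, so that real roots
  at \<open>x\<close> need no separate treatment.
\<close>

lemma Im_deriv_cnj_of_stable:
  assumes "hurwitz_stable P"
  shows "Im (poly (pderiv P) (of_real x) * cnj (poly P (of_real x))) \<le> 0"
    and "poly P w = 0 \<Longrightarrow> w \<notin> \<real> \<Longrightarrow> poly P (of_real x) \<noteq> 0 \<Longrightarrow>
      Im (poly (pderiv P) (of_real x) * cnj (poly P (of_real x))) < 0"
proof -
  define V where "V P = Im (poly (pderiv P) (of_real x) * cnj (poly P (of_real x)))" for P
  have "V P \<le> 0 \<and> (poly P w = 0 \<and> w \<notin> \<real> \<and> poly P (of_real x) \<noteq> 0 \<longrightarrow> V P < 0)"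
    using assms(1)
  proof (induction P rule: complex_poly_root_induct)
    case (const c)
    then show ?case by (auto simp: V_def)
  next
    case (root u P)
    have u: "Im u \<le> 0" and P: "hurwitz_stable P"
      using root.prems by (simp_all only: hurwitz_stable_root_factor)
    define z where "z = of_real x - u"
    have eq: "V ([:-u, 1:] * P) = (norm (poly P (of_real x)))\<^sup>2 * Im u + (norm z)\<^sup>2 * V P"
    proof -
      let ?A = "poly P (of_real x)" and ?B = "poly (pderiv P) (of_real x)"
      have "(?A + z * ?B) * cnj (z * ?A)
          = of_real ((norm ?A)\<^sup>2) * cnj z + of_real ((norm z)\<^sup>2) * (?B * cnj ?A)"
        unfolding complex_norm_square by (simp add: algebra_simps)
      moreover have "poly (pderiv ([:-u, 1:] * P)) (of_real x) = ?A + z * ?B"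
        unfolding pderiv_mult by (simp add: z_def pderiv_pCons algebra_simps)
      moreover have "poly ([:-u, 1:] * P) (of_real x) = z * ?A"
        by (simp add: z_def algebra_simps)
      ultimately have "V ([:-u, 1:] * P)
          = (norm ?A)\<^sup>2 * Im (cnj z) + (norm z)\<^sup>2 * Im (?B * cnj ?A)"
        unfolding V_def by (simp only: plus_complex.sel times_complex.sel Re_complex_of_real Im_complex_of_real
            mult_zero_left add_0_right)
      then show ?thesis by (simp add: V_def z_def)
    qed
    have 1: "(norm (poly P (of_real x)))\<^sup>2 * Im u \<le> 0"
      using u by (simp add: mult_nonneg_nonpos)
    have 2: "(norm z)\<^sup>2 * V P \<le> 0"
      using root.IH[OF P] by (simp add: mult_nonneg_nonpos)
    have "V ([:-u, 1:] * P) < 0"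
      if w: "poly ([:-u, 1:] * P) w = 0" "w \<notin> \<real>" and nz: "poly ([:-u, 1:] * P) (of_real x) \<noteq> 0"
    proof (cases "w = u")
      case True
      then have "Im u < 0" using u w(2) by (metis complex_is_Real_iff less_eq_real_def)
      then have "(norm (poly P (of_real x)))\<^sup>2 * Im u < 0"
        using nz by (simp add: mult_pos_neg)
      then show ?thesis using eq 2 by linarith
    next
      case False
      then have "poly P w = 0" using w by simp
      then have "V P < 0" using root.IH[OF P] w(2) nz by simp
      moreover have "z \<noteq> 0" using nz by (auto simp: z_def)
      ultimately have "(norm z)\<^sup>2 * V P < 0" by (simp add: mult_pos_neg)
      then show ?thesis using eq 1 by linarith
    qed
    then show ?case using eq 1 2 by auto
  qed
  then show "Im (poly (pderiv P) (of_real x) * cnj (poly P (of_real x))) \<le> 0"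
    and "poly P w = 0 \<Longrightarrow> w \<notin> \<real> \<Longrightarrow> poly P (of_real x) \<noteq> 0 \<Longrightarrow>
      Im (poly (pderiv P) (of_real x) * cnj (poly P (of_real x))) < 0"
    by (auto simp: V_def)
qed

definition stable_pair :: "real poly \<Rightarrow> real poly \<Rightarrow> bool" where
  "stable_pair f g \<longleftrightarrow> hurwitz_stable (cpoly f + smult \<i> (cpoly g))"

lemma wronskian_eq_Im:
  fixes f g :: "real poly"
  defines "P \<equiv> cpoly f + smult \<i> (cpoly g)"
  shows "poly (pderiv f * g - f * pderiv g) x
    = - Im (poly (pderiv P) (of_real x) * cnj (poly P (of_real x)))"
  by (simp add: P_def pderiv_add pderiv_smult pderiv_cpoly poly_cpoly_of_real)

lemma positively_oriented_of_stable_pair: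
  "stable_pair f g \<Longrightarrow> positively_oriented f g"
  unfolding stable_pair_def positively_oriented_def wronskian_eq_Im
  using Im_deriv_cnj_of_stable(1) neg_0_le_iff_le by blast

lemma stable_pair_reflect:
  assumes "stable_pair f g" "Im t \<ge> 0"
  shows "norm (poly (cpoly f) t - \<i> * poly (cpoly g) t) \<le> norm (poly (cpoly f) t + \<i> * poly (cpoly g) t)"
proof -
  have "norm (poly (cpoly f) t - \<i> * poly (cpoly g) t)
      = norm (cnj (poly (cpoly f) t - \<i> * poly (cpoly g) t))"
    by (simp only: complex_mod_cnj)
  also have "cnj (poly (cpoly f) t - \<i> * poly (cpoly g) t)
      = poly (cpoly f + smult \<i> (cpoly g)) (cnj t)"
    by (simp add: poly_cpoly_cnj)
  finally show ?thesis
    using norm_reflected_le[OF assms[unfolded stable_pair_def]] by simp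
qed

text \<open>
  The first hypothesis says that \<open>a / b\<close> lies in the closed upper half plane (or \<open>b = 0\<close>). So does
  \<open>a / (\<mu> b)\<close>, whereas a zero of the sum would make it equal to \<open>- \<i>\<close>.
\<close>

lemma scaled_pair_ne_0:
  fixes a b :: complex
  assumes "norm (a - \<i> * b) \<le> norm (a + \<i> * b)" "a + \<i> * b \<noteq> 0" "\<mu> > 0"
  shows "a + \<i> * of_real \<mu> * b \<noteq> 0"
proof
  assume "a + \<i> * of_real \<mu> * b = 0"
  then have "of_real (1 + \<mu>) * (a + \<i> * b) = of_real (\<mu> - 1) * (a - \<i> * b)"
    by (simp add: algebra_simps)
  then have "(1 + \<mu>) * norm (a + \<i> * b) = \<bar>\<mu> - 1\<bar> * norm (a - \<i> * b)"
    using assms(3) by (metis abs_of_pos add_pos_pos norm_mult norm_of_real zero_less_one)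
  also have "\<dots> \<le> \<bar>\<mu> - 1\<bar> * norm (a + \<i> * b)" using assms(1) by (simp add: mult_left_mono)
  also have "\<dots> < (1 + \<mu>) * norm (a + \<i> * b)" using assms(2,3) by (intro mult_strict_right_mono) auto
  finally show False by simp
qed

lemma stable_pair_swap: "stable_pair f g \<longleftrightarrow> stable_pair g (- f)"
proof -
  have "cpoly g + smult \<i> (cpoly (- f)) = smult (- \<i>) (cpoly f + smult \<i> (cpoly g))"
    by (simp add: cpoly_minus smult_add_right)
  then show ?thesis by (simp add: stable_pair_def hurwitz_stable_def)
qed

text \<open>
  By \<open>scaled_pair_ne_0\<close> the polynomial \<open>f + \<i> \<mu> g\<close> is stable for every \<open>\<mu> > 0\<close>, and \<open>f\<close> is its limit
  as \<open>\<mu>\<close> tends to 0. A real polynomial without zeros in the upper half plane has none in the lower one either.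
\<close>

lemma stable_pair_first:
  assumes "stable_pair f g"
  shows "real_hurwitz_stable f"
proof (rule ccontr)
  assume "\<not> real_hurwitz_stable f"
  then obtain t where "f \<noteq> 0" and "t \<notin> \<real>" "poly (cpoly f) t = 0"
    by (auto simp: real_hurwitz_stable_def real_rooted_def)
  define s0 where "s0 = (if Im t > 0 then t else cnj t)"
  have "Im s0 > 0" using \<open>t \<notin> \<real>\<close> by (auto simp: s0_def complex_is_Real_iff)
  have root: "poly (cpoly f) s0 = 0"
    using \<open>poly (cpoly f) t = 0\<close> by (simp add: s0_def poly_cpoly_cnj)
  define F where "F k = cpoly f + smult (\<i> * of_real (inverse (real (Suc k)))) (cpoly g)" for k
  have "poly (cpoly f) s = 0" for s
  proof (rule limit_of_root_free_eq_0[of F "max (degree f) (degree g)" s0 "Im s0" "poly (cpoly f)" s])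
    show "degree (F k) \<le> max (degree f) (degree g)" for k
      unfolding F_def
      by (rule order_trans[OF degree_add_le_max]) (auto simp: degree_map_poly)
    show "poly (F k) s \<noteq> 0" if "dist s0 s < Im s0" for k s
    proof -
      have "\<bar>Im (s0 - s)\<bar> < Im s0"
        using that abs_Im_le_cmod[of "s0 - s"] by (simp add: dist_norm)
      then have s: "Im s > 0" by simp
      have "poly (cpoly f) s + \<i> * poly (cpoly g) s \<noteq> 0"
        using assms s by (auto simp: stable_pair_def hurwitz_stable_def)
      then show ?thesis
        using scaled_pair_ne_0[OF stable_pair_reflect[OF assms, of s], of "inverse (real (Suc k))"] s
        by (simp add: F_def)
    qed
    show "Im s0 > 0" by fact
    show "(\<lambda>k. poly (F k) s) \<longlonglongrightarrow> poly (cpoly f) s" for s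
    proof -
      have "(\<lambda>k. poly (cpoly f) s + \<i> * of_real (inverse (real (Suc k))) * poly (cpoly g) s)
          \<longlonglongrightarrow> poly (cpoly f) s + \<i> * of_real 0 * poly (cpoly g) s"
        by (intro tendsto_intros LIMSEQ_inverse_real_of_nat)
      then show ?thesis by (simp add: F_def)
    qed
  qed (fact root)
  then show False using \<open>f \<noteq> 0\<close> poly_all_0_iff_0[of "cpoly f"] by simp
qed

lemma real_hurwitz_stable_uminus [simp]: "real_hurwitz_stable (- f) \<longleftrightarrow> real_hurwitz_stable f"
  by (simp add: real_hurwitz_stable_def real_rooted_def cpoly_minus)

lemma stable_pair_second:
  "stable_pair f g \<Longrightarrow> real_hurwitz_stable g"
  using stable_pair_swap stable_pair_first by blast

lemma stable_pair_nonzero: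
  "stable_pair f g \<Longrightarrow> f \<noteq> 0 \<or> g \<noteq> 0"
  by (auto simp: stable_pair_def hurwitz_stable_def dest: spec[of _ \<i>])

section \<open>Interlacing of the roots of a stable pair\<close>

lemma less_length_filter_le_iff:
  "sorted xs \<Longrightarrow> i < length (filter (\<lambda>a. a \<le> x) xs) \<longleftrightarrow> i < length xs \<and> xs ! i \<le> (x :: real)"
proof (induction xs arbitrary: i)
  case Nil
  then show ?case by simp
next
  case (Cons a xs)
  show ?case
  proof (cases "a \<le> x")
    case True
    then show ?thesis using Cons by (cases i) auto
  next
    case False
    then have "\<forall>b\<in>set (a # xs). \<not> b \<le> x" using Cons.prems by auto
    moreover from this have "filter (\<lambda>a. a \<le> x) (a # xs) = []" by (simp only: filter_empty_conv)
    ultimately show ?thesis using nth_mem[of i "a # xs"] by auto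
  qed
qed

text \<open>
  Alternation of the sorted lists, in terms of the numbers of entries up to \<open>x\<close>. In this form a
  multiset common to both sides cancels, which reduces interlacing to coprime polynomials.
\<close>

definition count_alternating :: "real multiset \<Rightarrow> real multiset \<Rightarrow> bool" where
  "count_alternating M N \<longleftrightarrow>
     (\<forall>x. size {#b \<in># N. b \<le> x#} \<le> size {#a \<in># M. a \<le> x#} \<and>
          size {#a \<in># M. a \<le> x#} \<le> Suc (size {#b \<in># N. b \<le> x#}))"

lemma count_alternating_add:
  "count_alternating M N \<Longrightarrow> count_alternating (D + M) (D + N)"
  by (simp add: count_alternating_def)

lemma alternating_of_count_alternating:
  assumes "count_alternating M N"
  shows "alternating (sorted_list_of_multiset M) (sorted_list_of_multiset N)"
proof -
  define as bs where "as = sorted_list_of_multiset M" and "bs = sorted_list_of_multiset N"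
  have "size {#a \<in># M. a \<le> x#} = length (filter (\<lambda>a. a \<le> x) (sorted_list_of_multiset M))" for x M
    by (metis mset_filter mset_sorted_list_of_multiset size_mset)
  then have cnt: "length (filter (\<lambda>a. a \<le> x) bs) \<le> length (filter (\<lambda>a. a \<le> x) as)"
      "length (filter (\<lambda>a. a \<le> x) as) \<le> Suc (length (filter (\<lambda>a. a \<le> x) bs))" for x
    using assms unfolding count_alternating_def as_def bs_def by metis+
  have as: "i < length (filter (\<lambda>a. a \<le> x) as) \<longleftrightarrow> i < length as \<and> as ! i \<le> x"
    and bs: "i < length (filter (\<lambda>a. a \<le> x) bs) \<longleftrightarrow> i < length bs \<and> bs ! i \<le> x" for i x
    unfolding as_def bs_def by (intro less_length_filter_le_iff sorted_sorted_list_of_multiset)+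
  have 1: "i < length as \<and> as ! i \<le> bs ! i" if "i < length bs" for i
    using cnt(1)[of "bs ! i"] bs[of i "bs ! i"] as[of i "bs ! i"] that by simp
  have 2: "i < length bs \<and> bs ! i \<le> as ! Suc i" if "Suc i < length as" for i
    using cnt(2)[of "as ! Suc i"] bs[of i "as ! Suc i"] as[of "Suc i" "as ! Suc i"] that by simp
  have "length bs \<le> length as" using 1 not_less by (metis less_irrefl)
  moreover have "length as \<le> Suc (length bs)" using 2[of "length bs"] by (auto simp: not_less[symmetric])
  ultimately have "length as = length bs \<or> length as = length bs + 1" by linarith
  then show ?thesis using 1 2 unfolding alternating_def as_def bs_def by simp
qed

definition separates :: "real set \<Rightarrow> real set \<Rightarrow> bool" where
  "separates B A \<longleftrightarrow> (\<forall>a\<in>A. \<forall>a'\<in>A. a < a' \<longrightarrow> (\<exists>b\<in>B. a < b \<and> b < a'))"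

lemma card_le_Suc_of_separates:
  assumes "finite A" "finite B" "separates B A"
  shows "card A \<le> Suc (card B)"
proof -
  have "card A \<le> Suc (card {b\<in>B. \<exists>a\<in>A. b < a})"
    using assms(1,3)
  proof (induction A rule: finite_linorder_max_induct)
    case empty
    then show ?case by simp
  next
    case (insert M A)
    show ?case
    proof (cases "A = {}")
      case True
      then show ?thesis by simp
    next
      case False
      then obtain b where b: "b \<in> B" "Max A < b" "b < M"
        using insert unfolding separates_def by (metis Max_in insertCI)
      have "card {b\<in>B. \<exists>a\<in>A. b < a} < card {b\<in>B. \<exists>a\<in>insert M A. b < a}"
      proof (rule psubset_card_mono)
        have "b \<notin> {b\<in>B. \<exists>a\<in>A. b < a}"
          using b insert.hyps(1) by (auto dest: Max_ge)
        then show "{b\<in>B. \<exists>a\<in>A. b < a} \<subset> {b\<in>B. \<exists>a\<in>insert M A. b < a}"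
          using b by blast
      qed (use assms(2) in simp)
      moreover have "card A \<le> Suc (card {b\<in>B. \<exists>a\<in>A. b < a})"
        using insert by (auto simp: separates_def)
      ultimately show ?thesis using insert.hyps by (simp add: card_insert_if)
    qed
  qed
  also have "\<dots> \<le> Suc (card B)"
    using assms(2) by (intro Suc_leI le_imp_less_Suc card_mono) auto
  finally show ?thesis .
qed

text \<open>
  Separation bounds each count by one plus the other. Every point of \<open>B\<close> has a point of \<open>A\<close> below it,
  so \<open>B\<close> can be given an extra point \<open>m\<close> below everything without losing separation; this improves
  one of the two bounds by one.
\<close>

lemma count_alternating_of_separates_aux:
  assumes "finite A" "finite B" "separates B A" "separates A B" and min: "\<forall>b\<in>B. \<exists>a\<in>A. a < b"
  shows "count_alternating (mset_set A) (mset_set B)"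
  unfolding count_alternating_def
proof
  fix x
  define Ax Bx where "Ax = {a\<in>A. a \<le> x}" and "Bx = {b\<in>B. b \<le> x}"
  have fin: "finite Ax" "finite Bx" using assms by (auto simp: Ax_def Bx_def)
  have "separates Bx Ax" using assms(3) unfolding separates_def Ax_def Bx_def by fastforce
  then have 1: "card Ax \<le> Suc (card Bx)" using card_le_Suc_of_separates fin by blast
  obtain m where m: "\<forall>c\<in>A \<union> B. m < c"
  proof
    show "\<forall>c\<in>A \<union> B. Min (A \<union> B) - 1 < c"
    proof
      fix c assume "c \<in> A \<union> B"
      then have "Min (A \<union> B) \<le> c" using assms(1,2) by (intro Min_le) auto
      then show "Min (A \<union> B) - 1 < c" by simp
    qed
  qed
  have "separates Ax (insert m Bx)"
    unfolding separates_def
  proof (intro ballI impI)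
    fix b b' assume b: "b \<in> insert m Bx" "b' \<in> insert m Bx" "b < b'"
    have "m \<le> b" using b(1) m by (auto simp: Bx_def intro: less_imp_le)
    then have "b' \<in> Bx" using b by simp
    show "\<exists>a\<in>Ax. b < a \<and> a < b'"
    proof (cases "b = m")
      case True
      obtain a where "a \<in> A" "a < b'" using min \<open>b' \<in> Bx\<close> by (auto simp: Bx_def)
      then show ?thesis using m \<open>b' \<in> Bx\<close> True by (intro bexI[of _ a]) (auto simp: Ax_def Bx_def)
    next
      case False
      then obtain a where "a \<in> A" "b < a" "a < b'"
        using assms(4) b \<open>b' \<in> Bx\<close> by (auto simp: separates_def Bx_def)
      then show ?thesis using \<open>b' \<in> Bx\<close> by (intro bexI[of _ a]) (auto simp: Ax_def Bx_def)
    qed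
  qed
  then have "card (insert m Bx) \<le> Suc (card Ax)"
    using card_le_Suc_of_separates fin by blast
  moreover have "m \<notin> Bx" using m by (auto simp: Bx_def)
  ultimately have "card Bx \<le> card Ax" using fin by simp
  then show "size {#b \<in># mset_set B. b \<le> x#} \<le> size {#a \<in># mset_set A. a \<le> x#} \<and>
      size {#a \<in># mset_set A. a \<le> x#} \<le> Suc (size {#b \<in># mset_set B. b \<le> x#})"
    using 1 assms(1,2) by (simp add: filter_mset_mset_set Ax_def Bx_def)
qed

lemma count_alternating_of_separates:
  assumes "finite A" "finite B" "separates B A" "separates A B" "A \<inter> B = {}"
  shows "count_alternating (mset_set A) (mset_set B) \<or> count_alternating (mset_set B) (mset_set A)"
proof -
  have "(\<forall>b\<in>B. \<exists>a\<in>A. a < b) \<or> (\<forall>a\<in>A. \<exists>b\<in>B. b < a)"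
  proof (rule ccontr)
    assume "\<not> ?thesis"
    then obtain a b where "a \<in> A" "b \<in> B" "\<forall>a'\<in>A. \<not> a' < b" "\<forall>b'\<in>B. \<not> b' < a" by blast
    then have "a = b" by (meson linorder_neqE)
    then show False using assms(5) \<open>a \<in> A\<close> \<open>b \<in> B\<close> by blast
  qed
  then show ?thesis using count_alternating_of_separates_aux assms by blast
qed

text \<open>
  On an interval free of roots of \<open>g\<close> the quotient \<open>f / g\<close> has derivative \<open>(f' g - f g') / g\<^sup>2 > 0\<close>, so it
  cannot vanish at both ends.
\<close>

lemma roots_separated:
  fixes f g :: "real poly"
  assumes W: "\<And>x. poly (pderiv f * g - f * pderiv g) x > 0"
  shows "separates {x. poly g x = 0} {x. poly f x = 0}"
  unfolding separates_def
proof (intro ballI impI, rule ccontr)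
  fix a a' assume a: "a \<in> {x. poly f x = 0}" "a' \<in> {x. poly f x = 0}" "a < a'"
  assume "\<not> (\<exists>b\<in>{x. poly g x = 0}. a < b \<and> b < a')"
  then have g: "poly g b \<noteq> 0" if "a \<le> b" "b \<le> a'" for b
    using that a W[of a] W[of a'] by (cases "b = a \<or> b = a'") (auto simp: less_le)
  have der: "((\<lambda>x. poly f x / poly g x) has_real_derivative
      poly (pderiv f * g - f * pderiv g) x / (poly g x)\<^sup>2) (at x)" if "a \<le> x" "x \<le> a'" for x
    using g[OF that] by (auto intro!: derivative_eq_intros poly_DERIV simp: power2_eq_square algebra_simps)
  obtain z where z: "a < z" "z < a'" and
    "poly f a' / poly g a' - poly f a / poly g a
      = (a' - a) * (poly (pderiv f * g - f * pderiv g) z / (poly g z)\<^sup>2)"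
    using MVT2[OF a(3) der] by blast
  then have "poly (pderiv f * g - f * pderiv g) z / (poly g z)\<^sup>2 = 0"
    using a by simp
  then show False using W[of z] g[of z] z by simp
qed

lemma proots_eq_mset_set:
  assumes "rsquarefree f"
  shows "proots f = mset_set {x. poly f x = 0}"
proof -
  have "f \<noteq> 0" using assms by (simp add: rsquarefree_def)
  then have "finite {x. poly f x = 0}" by (rule poly_roots_finite)
  moreover have "order a f = (if poly f a = 0 then 1 else 0)" for a
    using assms \<open>f \<noteq> 0\<close> by (auto simp: order_root rsquarefree_root_order)
  ultimately show ?thesis using \<open>f \<noteq> 0\<close> by (intro multiset_eqI) (simp add: count_mset_set')
qed

text \<open>
  The Wronskian of \<open>(g, - f)\<close> is that of \<open>(f, g)\<close>, so the roots of each polynomial separate those of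
  the other. At a multiple root the Wronskian would vanish; hence counting roots with multiplicity is
  counting points.
\<close>

lemma count_alternating_of_wronskian_pos:
  fixes f g :: "real poly"
  assumes W: "\<And>x. poly (pderiv f * g - f * pderiv g) x > 0"
  shows "count_alternating (proots f) (proots g) \<or> count_alternating (proots g) (proots f)"
proof -
  let ?A = "{x. poly f x = 0}" and ?B = "{x. poly g x = 0}"
  have "rsquarefree f" "rsquarefree g"
    unfolding rsquarefree_roots using W by (metis diff_self less_irrefl mult_zero_left mult_zero_right poly_diff poly_mult)+
  moreover have "f \<noteq> 0" "g \<noteq> 0" using W[of 0] by auto
  moreover have "separates ?B ?A" by (rule roots_separated[OF W])
  moreover have "separates ?A ?B"
    using roots_separated[of g "- f"] W by (simp add: pderiv_minus algebra_simps)
  moreover have "poly f x \<noteq> 0 \<or> poly g x \<noteq> 0" for x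
    using W[of x] by auto
  then have "?A \<inter> ?B = {}" by blast
  ultimately show ?thesis
    using count_alternating_of_separates[of ?A ?B] by (simp add: proots_eq_mset_set poly_roots_finite)
qed

lemma stable_pair_of_mult:
  assumes "stable_pair (f * d) (g * d)"
  shows "stable_pair f g"
proof -
  have "cpoly (f * d) + smult \<i> (cpoly (g * d)) = (cpoly f + smult \<i> (cpoly g)) * cpoly d"
    by (simp add: cpoly_mult algebra_simps)
  then show ?thesis using assms by (simp add: stable_pair_def hurwitz_stable_def)
qed

text \<open>
  After division by the greatest common divisor, \<open>f + \<i> g\<close> has no real root, so if it is not constant
  its Wronskian is strictly positive; the common factor adds the same roots on both sides.
\<close>

lemma interlacing_of_stable_pair:
  assumes "stable_pair f g"
  shows "interlacing f g"
proof (cases "f = 0 \<or> g = 0")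
  case True
  then show ?thesis using stable_pair_nonzero[OF assms] by (auto simp: interlacing_def)
next
  case False
  define d where "d = gcd f g"
  have "d \<noteq> 0" using False by (simp add: d_def)
  then obtain f1 g1 where fg: "f = f1 * d" "g = g1 * d" and co: "coprime f1 g1"
    using gcd_coprime_exists[of f g] unfolding d_def by blast
  have nz: "f1 \<noteq> 0" "g1 \<noteq> 0" using False fg by auto
  have st: "stable_pair f1 g1" using assms fg stable_pair_of_mult by blast
  define P where "P = cpoly f1 + smult \<i> (cpoly g1)"
  have P: "hurwitz_stable P" using st by (simp add: stable_pair_def P_def)
  have no_real: "poly P (of_real x) \<noteq> 0" for x
  proof
    assume "poly P (of_real x) = 0"
    then have "poly f1 x = 0" "poly g1 x = 0"
      by (simp_all add: P_def poly_cpoly_of_real complex_eq_iff)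
    then have "[:-x, 1:] dvd f1" "[:-x, 1:] dvd g1" by (simp_all add: poly_eq_0_iff_dvd)
    then have "is_unit [:-x, 1:]" using co by (meson coprime_common_divisor)
    then show False by (simp add: is_unit_pCons_iff)
  qed
  have "count_alternating (proots f1) (proots g1) \<or> count_alternating (proots g1) (proots f1)"
  proof (cases "\<exists>w. poly P w = 0")
    case True
    then obtain w where w: "poly P w = 0" "w \<notin> \<real>" using no_real by (auto elim: Reals_cases)
    have "poly (pderiv f1 * g1 - f1 * pderiv g1) x > 0" for x
      unfolding wronskian_eq_Im P_def[symmetric]
      using Im_deriv_cnj_of_stable(2)[OF P w no_real, of x] by linarith
    then show ?thesis by (rule count_alternating_of_wronskian_pos)
  next
    case False
    then have "degree P = 0" using alg_closed_imp_poly_has_root[of P] by auto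
    have "coeff f1 k = 0 \<and> coeff g1 k = 0" if "k > 0" for k
    proof -
      have "coeff P k = 0" using \<open>degree P = 0\<close> that by (simp add: coeff_eq_0)
      then show ?thesis by (simp add: P_def coeff_map_poly complex_eq_iff)
    qed
    then have "degree f1 = 0" "degree g1 = 0"
      by (metis gr0I leading_coeff_0_iff degree_0)+
    then have "proots f1 = {#}" "proots g1 = {#}"
      by (auto elim!: degree_eq_zeroE)
    then show ?thesis by (simp add: count_alternating_def)
  qed
  then have "count_alternating (proots f) (proots g) \<or> count_alternating (proots g) (proots f)"
    using count_alternating_add[of "proots f1" "proots g1" "proots d"]
      count_alternating_add[of "proots g1" "proots f1" "proots d"] nz \<open>d \<noteq> 0\<close>
    unfolding fg by (auto simp: proots_mult add.commute[of _ "proots d"])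
  then show ?thesis
    using False alternating_of_count_alternating by (auto simp: interlacing_def real_zeroes_def)
qed

section \<open>Stability from interlacing roots\<close>

text \<open>
  Removing the first entry exchanges the roles of the two lists, which is the induction step of the
  next lemma.
\<close>

lemma alternating_Cons:
  assumes "alternating (a # as) bs"
  shows "alternating bs as" "bs \<noteq> [] \<Longrightarrow> a \<le> hd bs"
proof -
  have len: "length (a # as) = length bs \<or> length (a # as) = length bs + 1"
    and 1: "\<And>i. i < length bs \<Longrightarrow> (a # as) ! i \<le> bs ! i"
    and 2: "\<And>i. i + 1 < length (a # as) \<Longrightarrow> bs ! i \<le> (a # as) ! (i + 1)"
    using assms unfolding alternating_def by blast+
  show "alternating bs as"
    unfolding alternating_def
  proof (intro conjI allI impI)
    show "length bs = length as \<or> length bs = length as + 1" using len by auto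
    show "bs ! i \<le> as ! i" if "i < length as" for i using 2[of i] that by simp
    show "as ! i \<le> bs ! (i + 1)" if "i + 1 < length bs" for i using 1[of "i + 1"] that by simp
  qed
  show "a \<le> hd bs" if "bs \<noteq> []" using 1[of 0] that by (simp add: hd_conv_nth)
qed

text \<open>
  The quotient of the two products lies in the convex cone spanned by \<open>1\<close> and \<open>x - s\<close>, for every \<open>x\<close>
  below all entries. If \<open>B / A\<close> lies in the cone of \<open>1\<close> and \<open>u = a - s\<close>, then \<open>u A / B\<close> is a positive
  multiple of \<open>u cnj (B / A)\<close>, which lies in the cone of \<open>u\<close> and \<open>\<bar>u\<bar>\<^sup>2\<close>; and \<open>u\<close> itself is
  \<open>(a - x) + (x - s)\<close> with \<open>a - x \<ge> 0\<close>. In terms of arguments, for \<open>s\<close> in the lower half plane: an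
  alternating sum of decreasing angles between 0 and \<open>\<pi>\<close> stays between 0 and the first of them.
\<close>

lemma alternating_prod_quotient:
  assumes "alternating as bs" "as \<noteq> [] \<Longrightarrow> x \<le> hd as" "s \<notin> \<real>"
  shows "\<exists>\<alpha>\<ge>0. \<exists>\<beta>\<ge>0. (\<Prod>a\<leftarrow>as. complex_of_real a - s)
    = (of_real \<alpha> + of_real \<beta> * (of_real x - s)) * (\<Prod>b\<leftarrow>bs. of_real b - s)"
  using assms(1,2)
proof (induction "length as + length bs" arbitrary: as bs x rule: less_induct)
  case less
  show ?case
  proof (cases as)
    case Nil
    then have "bs = []" using less.prems by (simp add: alternating_def)
    then show ?thesis using Nil by (intro exI[of _ 1] conjI exI[of _ 0]) auto
  next
    case (Cons a as')
    let ?A = "\<Prod>a\<leftarrow>as'. complex_of_real a - s" and ?B = "\<Prod>b\<leftarrow>bs. complex_of_real b - s"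
    let ?u = "complex_of_real a - s"
    have "alternating bs as'" "bs \<noteq> [] \<Longrightarrow> a \<le> hd bs"
      using less.prems(1) alternating_Cons unfolding Cons by blast+
    then obtain l m where lm: "l \<ge> 0" "m \<ge> 0" and B: "?B = (of_real l + of_real m * ?u) * ?A"
      using less.hyps[of bs as' a] Cons by auto
    have "?B \<noteq> 0" using assms(3) by (auto simp: prod_list_zero_iff)
    define \<kappa> where "\<kappa> = of_real l + of_real m * ?u"
    have "\<kappa> \<noteq> 0" using B \<open>?B \<noteq> 0\<close> by (auto simp: \<kappa>_def)
    define N where "N = (norm \<kappa>)\<^sup>2"
    have "N > 0" using \<open>\<kappa> \<noteq> 0\<close> by (simp add: N_def)
    have "x \<le> a" using less.prems(2) Cons by simp
    define \<alpha> where "\<alpha> = (m * (norm ?u)\<^sup>2 + l * (a - x)) / N"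
    define \<beta> where "\<beta> = l / N"
    have "cnj \<kappa> * ?u = of_real l * ?u + of_real m * of_real ((norm ?u)\<^sup>2)"
      unfolding complex_norm_square by (simp add: \<kappa>_def algebra_simps)
    also have "\<dots> = of_real N * (of_real \<alpha> + of_real \<beta> * (of_real x - s))"
      using \<open>N > 0\<close> by (simp add: \<alpha>_def \<beta>_def field_simps)
    finally have "\<kappa> * (cnj \<kappa> * ?u) = \<kappa> * (of_real N * (of_real \<alpha> + of_real \<beta> * (of_real x - s)))"
      by simp
    moreover have "\<kappa> * cnj \<kappa> = of_real N" unfolding N_def complex_norm_square ..
    ultimately have "of_real N * ?u = of_real N * (\<kappa> * (of_real \<alpha> + of_real \<beta> * (of_real x - s)))"
      by (simp only: mult.assoc[symmetric]) (simp only: mult_ac)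
    then have "?u = \<kappa> * (of_real \<alpha> + of_real \<beta> * (of_real x - s))" using \<open>N > 0\<close> by simp
    then have "?u * ?A = (of_real \<alpha> + of_real \<beta> * (of_real x - s)) * ?B"
      unfolding B \<kappa>_def[symmetric] by simp
    moreover have "\<alpha> \<ge> 0" "\<beta> \<ge> 0"
      using lm \<open>N > 0\<close> \<open>x \<le> a\<close> by (auto simp: \<alpha>_def \<beta>_def)
    ultimately show ?thesis using Cons by auto
  qed
qed

lemma real_rooted_splits:
  assumes "real_rooted f"
  shows "size (proots f) = degree f \<and>
    (\<exists>k. k \<noteq> 0 \<and> (\<forall>s. poly (cpoly f) s = of_real k * (\<Prod>a\<in>#proots f. of_real a - s)))"
  using assms
proof (induction "degree f" arbitrary: f)
  case 0
  then obtain k where "f = [:k:]" by (auto elim!: degree_eq_zeroE)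
  moreover from this have "k \<noteq> 0"
    using 0(2) by (auto simp: real_rooted_def complex_is_Real_iff dest: spec[of _ \<i>])
  ultimately show ?case by (intro conjI exI[of _ k]) (simp_all add: map_poly_pCons)
next
  case (Suc n)
  then have "degree (cpoly f) \<noteq> 0" by (simp add: degree_map_poly)
  then obtain t where "poly (cpoly f) t = 0" using alg_closed_imp_poly_has_root[of "cpoly f"] by auto
  moreover from this have "t \<in> \<real>" using Suc.prems by (simp add: real_rooted_def)
  ultimately obtain a where "poly f a = 0" by (auto elim!: Reals_cases simp: poly_cpoly_of_real)
  then obtain h where h: "f = [:-a, 1:] * h" by (auto simp: poly_eq_0_iff_dvd)
  have "h \<noteq> 0" using h Suc.hyps(2) by auto
  have eq: "poly (cpoly f) s = (s - of_real a) * poly (cpoly h) s" for s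
    unfolding h cpoly_mult by (simp add: map_poly_pCons algebra_simps)
  have deg: "degree f = Suc (degree h)" unfolding h using \<open>h \<noteq> 0\<close> by (subst degree_mult_eq) auto
  have "real_rooted h" using Suc.prems eq by (auto simp: real_rooted_def)
  then obtain k where size: "size (proots h) = degree h" and k: "k \<noteq> 0"
    "\<And>s. poly (cpoly h) s = of_real k * (\<Prod>a\<in>#proots h. of_real a - s)"
    using Suc.hyps deg by auto
  have roots: "proots f = add_mset a (proots h)"
    unfolding h using \<open>h \<noteq> 0\<close> by (subst proots_mult) auto
  with k have "poly (cpoly f) s = of_real (- k) * (\<Prod>a\<in>#proots f. of_real a - s)" for s
    unfolding eq by (simp add: algebra_simps)
  moreover have "size (proots f) = degree f"
    using size roots deg by simp
  ultimately show ?case using k(1) by (intro conjI exI[of _ "- k"]) auto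
qed

lemma degree_le_Suc_of_interlacing:
  assumes "interlacing f g" "real_rooted f" "f \<noteq> 0" "g \<noteq> 0"
  shows "degree f \<le> Suc (degree g)"
proof -
  have "length (real_zeroes f) \<le> Suc (length (real_zeroes g))"
    using assms by (auto simp: interlacing_def alternating_def)
  then have "size (proots f) \<le> Suc (size (proots g))"
    unfolding real_zeroes_def by (metis mset_sorted_list_of_multiset size_mset)
  then show ?thesis
    using real_rooted_splits[OF assms(2)] size_proots_le[of g] by simp
qed

lemma real_rooted_splits_list:
  assumes "real_rooted f"
  obtains k where "k \<noteq> 0"
    "\<And>s. poly (cpoly f) s = of_real k * (\<Prod>a\<leftarrow>real_zeroes f. of_real a - s)"
proof -
  have "(\<Prod>a\<leftarrow>real_zeroes f. of_real a - s) = (\<Prod>a\<in>#proots f. complex_of_real a - s)" for s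
    unfolding real_zeroes_def
    by (metis mset_map mset_sorted_list_of_multiset prod_mset_prod_list)
  then show ?thesis using real_rooted_splits[OF assms] that by metis
qed

text \<open>
  For \<open>s\<close> in the lower half plane the quotient \<open>f s / g s\<close> is a real constant times a point of the closed
  upper half plane. A zero of \<open>f + \<i> g\<close> in the upper half plane, conjugated, makes this quotient equal to
  \<open>\<i>\<close>, a zero of \<open>f - \<i> g\<close> makes it \<open>- \<i>\<close>; the sign of the constant excludes one of them.
\<close>

lemma stable_pair_of_alternating:
  assumes "real_rooted f" "real_rooted g" "alternating (real_zeroes f) (real_zeroes g)"
  shows "stable_pair f g \<or> stable_pair f (- g)"
proof -
  obtain k where k: "k \<noteq> 0"
    "\<And>s. poly (cpoly f) s = of_real k * (\<Prod>a\<leftarrow>real_zeroes f. of_real a - s)"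
    using real_rooted_splits_list[OF assms(1)] by blast
  obtain l where l: "l \<noteq> 0"
    "\<And>s. poly (cpoly g) s = of_real l * (\<Prod>a\<leftarrow>real_zeroes g. of_real a - s)"
    using real_rooted_splits_list[OF assms(2)] by blast
  have key: "k * e * l \<ge> 0"
    if "Im t > 0" "poly (cpoly f) t + \<i> * (of_real e * poly (cpoly g) t) = 0" "e \<noteq> 0" for t e
  proof -
    define s where "s = cnj t"
    have s: "Im s < 0" "s \<notin> \<real>" using that by (auto simp: s_def complex_is_Real_iff)
    let ?B = "\<Prod>b\<leftarrow>real_zeroes g. of_real b - s"
    have "?B \<noteq> 0" using s by (auto simp: prod_list_zero_iff)
    \<comment> \<open>For an empty list the condition on its head is void, and any real number would do.\<close>
    obtain \<alpha> \<beta> where lm: "\<alpha> \<ge> 0" "\<beta> \<ge> 0" and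
      A: "(\<Prod>a\<leftarrow>real_zeroes f. of_real a - s)
        = (of_real \<alpha> + of_real \<beta> * (of_real (hd (real_zeroes f)) - s)) * ?B"
      using alternating_prod_quotient[OF assms(3) _ s(2)] by blast
    define \<kappa> where "\<kappa> = of_real \<alpha> + of_real \<beta> * (of_real (hd (real_zeroes f)) - s)"
    have "cnj (poly (cpoly f) t + \<i> * (of_real e * poly (cpoly g) t)) = 0"
      using that by simp
    then have "poly (cpoly f) s - \<i> * (of_real e * poly (cpoly g) s) = 0"
      by (simp add: s_def poly_cpoly_cnj)
    then have "(of_real k * \<kappa> - \<i> * of_real e * of_real l) * ?B = 0"
      unfolding k(2) l(2) A \<kappa>_def[symmetric] by (simp add: algebra_simps)
    then have "of_real k * \<kappa> = \<i> * of_real e * of_real l" using \<open>?B \<noteq> 0\<close> by simp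
    from arg_cong[OF this, of Im] have "k * Im \<kappa> = e * l" by simp
    moreover have "Im \<kappa> \<ge> 0" using lm s by (simp add: \<kappa>_def mult_nonneg_nonpos)
    moreover have "k * e * l = k * (e * l)" by simp
    ultimately have "k * e * l = k\<^sup>2 * Im \<kappa>" by (simp add: power2_eq_square)
    then show ?thesis using \<open>Im \<kappa> \<ge> 0\<close> by simp
  qed
  show ?thesis
  proof (cases "k * l < 0")
    case True
    then have "stable_pair f g"
      using key[of _ 1] by (fastforce simp: stable_pair_def hurwitz_stable_def)
    then show ?thesis ..
  next
    case False
    then have "k * l > 0" using k l by (meson linorder_neqE mult_eq_0_iff)
    then have "stable_pair f (- g)"
      using key[of _ "- 1"] by (fastforce simp: stable_pair_def hurwitz_stable_def cpoly_minus)
    then show ?thesis ..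
  qed
qed

text \<open>
  Stability of \<open>f - \<i> g\<close> makes the Wronskian of \<open>(f, g)\<close> nonpositive, so it vanishes identically. By the
  strict part of the Wronskian inequality \<open>f - \<i> g\<close> has real roots only, and so has \<open>f + \<i> g\<close>.
\<close>

lemma stable_pair_of_reversed:
  assumes "stable_pair f (- g)" "positively_oriented f g"
  shows "stable_pair f g"
proof -
  define P where "P = cpoly f + smult \<i> (cpoly (- g))"
  have P: "hurwitz_stable P" using assms(1) by (simp add: stable_pair_def P_def)
  then have "P \<noteq> 0" by (auto simp: hurwitz_stable_def dest: spec[of _ \<i>])
  have real: "w \<in> \<real>" if "poly P w = 0" for w
  proof (rule ccontr)
    assume "w \<notin> \<real>"
    have "finite (complex_of_real -` {z. poly P z = 0})"
      by (rule finite_vimageI) (auto simp: poly_roots_finite \<open>P \<noteq> 0\<close> inj_def)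
    then have "\<exists>x. x \<notin> complex_of_real -` {z. poly P z = 0}"
      using ex_new_if_finite infinite_UNIV_char_0 by blast
    then obtain x where "poly P (of_real x) \<noteq> 0" by auto
    then have "poly (pderiv f * (- g) - f * pderiv (- g)) x > 0"
      unfolding wronskian_eq_Im P_def[symmetric]
      using Im_deriv_cnj_of_stable(2)[OF P that \<open>w \<notin> \<real>\<close>, of x] by linarith
    moreover have "poly (pderiv f * g - f * pderiv g) x \<ge> 0"
      using assms(2) by (simp only: positively_oriented_def)
    ultimately show False by (simp add: pderiv_minus)
  qed
  show ?thesis
    unfolding stable_pair_def hurwitz_stable_def
  proof (intro allI impI notI)
    fix t assume "Im t > 0" "poly (cpoly f + smult \<i> (cpoly g)) t = 0"
    then have "cnj (poly (cpoly f + smult \<i> (cpoly g)) t) = 0" by simp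
    then have "poly P (cnj t) = 0" by (simp add: P_def poly_cpoly_cnj cpoly_minus)
    then have "cnj t \<in> \<real>" by (rule real)
    then show False using \<open>Im t > 0\<close> by (simp add: complex_is_Real_iff)
  qed
qed

text \<open>
  The Hermite--Biehler theorem for pairs that may have common real roots, and in which one member may
  be zero.
\<close>

theorem hermite_biehler:
  "stable_pair f g \<longleftrightarrow>
     real_hurwitz_stable f \<and> real_hurwitz_stable g \<and> interlacing f g \<and> positively_oriented f g"
    (is "_ \<longleftrightarrow> ?R")
proof
  assume "stable_pair f g"
  then show ?R
    using stable_pair_first stable_pair_second interlacing_of_stable_pair
      positively_oriented_of_stable_pair by blast
next
  assume R: ?R
  then have rr: "f \<noteq> 0 \<Longrightarrow> real_rooted f" "g \<noteq> 0 \<Longrightarrow> real_rooted g"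
    by (auto simp: real_hurwitz_stable_def)
  have rr_ne: "poly (cpoly h) t \<noteq> 0" if "real_rooted h" "Im t > 0" for h t
    using that by (auto simp: real_rooted_def complex_is_Real_iff)
  consider "f = 0" "g \<noteq> 0" | "g = 0" "f \<noteq> 0" | "f \<noteq> 0" "g \<noteq> 0"
    using R by (auto simp: interlacing_def)
  then show "stable_pair f g"
  proof cases
    case 3
    then have "alternating (real_zeroes f) (real_zeroes g) \<or> alternating (real_zeroes g) (real_zeroes f)"
      using R by (simp add: interlacing_def)
    then have "stable_pair f g \<or> stable_pair f (- g)"
    proof
      assume "alternating (real_zeroes f) (real_zeroes g)"
      then show ?thesis using stable_pair_of_alternating rr 3 by blast
    next
      assume "alternating (real_zeroes g) (real_zeroes f)"
      then have "stable_pair g f \<or> stable_pair g (- f)" using stable_pair_of_alternating rr 3 by blast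
      then show ?thesis using stable_pair_swap by blast
    qed
    then show ?thesis using stable_pair_of_reversed R by blast
  qed (use rr rr_ne in \<open>auto simp: stable_pair_def hurwitz_stable_def\<close>)
qed

lemma value_over_lead_coeff_real:
  fixes P :: "complex poly"
  assumes "\<And>w. poly P w = 0 \<Longrightarrow> w \<in> \<real>"
  shows "poly P (of_real x) / lead_coeff P \<in> \<real>"
  using assms
proof (induction P rule: complex_poly_root_induct)
  case (const c)
  then show ?case by (cases "c = 0") auto
next
  case (root w P)
  have "w \<in> \<real>" using root.prems[of w] by simp
  have "poly P (of_real x) / lead_coeff P \<in> \<real>" using root.prems by (intro root.IH) simp
  then have "(of_real x - w) * (poly P (of_real x) / lead_coeff P) \<in> \<real>"
    using \<open>w \<in> \<real>\<close> by (intro Reals_mult Reals_diff Reals_of_real)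
  moreover have "lead_coeff ([:-w, 1:] * P) = lead_coeff P"
    unfolding lead_coeff_mult by simp
  ultimately show ?case by (simp add: algebra_simps)
qed

section \<open>Values, lines and homogeneous components of multivariate polynomials\<close>

definition monom_value :: "('a::comm_semiring_1) ^ 'd \<Rightarrow> ('d::finite \<Rightarrow>\<^sub>0 nat) \<Rightarrow> 'a" where
  "monom_value z m = (\<Prod>i\<in>UNIV. (z $ i) ^ Poly_Mapping.lookup m i)"

lemma mpoly_eval_superset:
  assumes "finite S" "Poly_Mapping.keys p \<subseteq> S"
  shows "mpoly_eval p z = (\<Sum>m\<in>S. Poly_Mapping.lookup p m * monom_value z m)"
  unfolding mpoly_eval_def monom_value_def
  using assms by (intro sum.mono_neutral_left) (auto simp: in_keys_iff)

lemma mpoly_eval_0 [simp]: "mpoly_eval 0 z = 0"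
  by (simp add: mpoly_eval_def)

lemma mpoly_eval_add: "mpoly_eval (p + q) z = mpoly_eval p z + mpoly_eval q z"
proof -
  let ?S = "Poly_Mapping.keys p \<union> Poly_Mapping.keys q"
  have "Poly_Mapping.keys (p + q) \<subseteq> ?S" by (rule Poly_Mapping.keys_add)
  then show ?thesis
    by (simp add: mpoly_eval_superset[of ?S] lookup_add algebra_simps sum.distrib)
qed

lemma lookup_mpoly_const_times [simp]:
  "Poly_Mapping.lookup (mpoly_const c * p) m = (c :: 'a :: comm_semiring_1) * Poly_Mapping.lookup p m"
  unfolding mpoly_const_def mult_map_scale_conv_mult[symmetric] Poly_Mapping.map.rep_eq
  by (simp add: when_def)

lemma mpoly_eval_const_times: "mpoly_eval (mpoly_const c * p) z = c * mpoly_eval p z"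
proof -
  have "Poly_Mapping.keys (mpoly_const c * p) \<subseteq> Poly_Mapping.keys p"
    by (auto simp: in_keys_iff)
  then show ?thesis
    by (simp add: mpoly_eval_superset[of "Poly_Mapping.keys p"] sum_distrib_left mult.assoc)
qed

lemma lookup_cmpoly [simp]:
  "Poly_Mapping.lookup (cmpoly p) m = complex_of_real (Poly_Mapping.lookup p m)"
  unfolding cmpoly_def Poly_Mapping.map.rep_eq by (simp add: when_def)

lemma keys_cmpoly [simp]: "Poly_Mapping.keys (cmpoly p) = Poly_Mapping.keys p"
  by (auto simp: in_keys_iff)

lemma mpoly_eval_cmpoly_cvec:
  "mpoly_eval (cmpoly p) (cvec x) = complex_of_real (mpoly_eval p x)"
  by (simp add: mpoly_eval_def cvec_def)

lemma poly_mpoly_line: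
  "poly (mpoly_line p x y) t = mpoly_eval p (x + t *s y)"
  by (simp add: mpoly_line_def mpoly_eval_def poly_sum poly_prod poly_power)

lemma cpoly_mpoly_line:
  "cpoly (mpoly_line p x y) = mpoly_line (cmpoly p) (cvec x) (cvec y)"
proof -
  have sum: "cpoly (sum f A) = (\<Sum>a\<in>A. cpoly (f a))" for f :: "'c \<Rightarrow> real poly" and A
    by (induction A rule: infinite_finite_induct) (simp_all add: cpoly_add)
  have prod: "cpoly (prod f A) = (\<Prod>a\<in>A. cpoly (f a))" for f :: "'c \<Rightarrow> real poly" and A
    by (induction A rule: infinite_finite_induct) (simp_all add: cpoly_mult)
  have power: "cpoly (f ^ k) = cpoly f ^ k" for f k
    by (induction k) (simp_all add: cpoly_mult)
  show ?thesis
    by (simp add: mpoly_line_def sum prod power cpoly_smult map_poly_pCons cvec_def)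
qed

lemma total_degree_le_iff:
  "total_degree p \<le> k \<longleftrightarrow> (\<forall>m\<in>Poly_Mapping.keys p. monom_degree m \<le> k)"
  by (simp add: total_degree_def)

lemma lookup_hom_component:
  "Poly_Mapping.lookup (hom_component j p) m = (if monom_degree m = j then Poly_Mapping.lookup p m else 0)"
  unfolding hom_component_def lookup_sum
  by (auto simp: lookup_single when_def sum.delta in_keys_iff)

lemma hom_component_cmpoly: "hom_component j (cmpoly p) = cmpoly (hom_component j p)"
  by (rule poly_mapping_eqI) (simp add: lookup_hom_component)

lemma total_degree_cmpoly: "total_degree (cmpoly p) = total_degree p"
  by (simp add: total_degree_def)

lemma homogeneous_hom_component [simp]: "homogeneous (hom_component j p)"
  unfolding homogeneous_def by (auto simp: in_keys_iff lookup_hom_component split: if_splits)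

lemma hom_component_total_degree_ne_0:
  assumes "p \<noteq> 0"
  shows "hom_component (total_degree p) p \<noteq> 0"
proof -
  let ?D = "monom_degree ` Poly_Mapping.keys p"
  have "?D \<noteq> {}" using assms by simp
  then have "total_degree p = Max ?D" unfolding total_degree_def by (subst Max_insert) auto
  then have "total_degree p \<in> ?D" using \<open>?D \<noteq> {}\<close> by (metis Max_in finite_imageI finite_keys)
  then obtain m where "m \<in> Poly_Mapping.keys p" "monom_degree m = total_degree p" by auto
  then have "Poly_Mapping.lookup (hom_component (total_degree p) p) m \<noteq> 0"
    by (simp add: lookup_hom_component in_keys_iff)
  then show ?thesis by auto
qed

lemma monom_value_scale: "monom_value (c *s z) m = c ^ monom_degree m * monom_value z m"
  by (simp add: monom_value_def monom_degree_def power_mult_distrib prod.distrib power_sum)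

lemma mpoly_eval_hom_component:
  "mpoly_eval (hom_component j p) z
    = (\<Sum>m\<in>Poly_Mapping.keys p. if monom_degree m = j then Poly_Mapping.lookup p m * monom_value z m else 0)"
proof -
  have "Poly_Mapping.keys (hom_component j p) \<subseteq> Poly_Mapping.keys p"
    by (auto simp: in_keys_iff lookup_hom_component split: if_splits)
  then show ?thesis
    by (subst mpoly_eval_superset[of "Poly_Mapping.keys p"])
      (auto simp: lookup_hom_component intro!: sum.cong)
qed

lemma mpoly_eval_hom_component_scale:
  "mpoly_eval (hom_component j p) (c *s z) = c ^ j * mpoly_eval (hom_component j p) z"
  unfolding mpoly_eval_hom_component sum_distrib_left
  by (intro sum.cong) (auto simp: monom_value_scale algebra_simps)

lemma coeff_mult_at_degree_bounds:
  assumes "degree f \<le> m" "degree g \<le> n"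
  shows "coeff (f * g) (m + n) = coeff f m * coeff g n"
proof -
  have "coeff (f * g) (m + n) = (\<Sum>i\<in>{m}. coeff f i * coeff g (m + n - i))"
    unfolding coeff_mult
  proof (rule sum.mono_neutral_right)
    show "\<forall>i\<in>{..m + n} - {m}. coeff f i * coeff g (m + n - i) = 0"
    proof
      fix i assume "i \<in> {..m + n} - {m}"
      then have "i > m \<or> m + n - i > n" by auto
      then show "coeff f i * coeff g (m + n - i) = 0"
        using assms by (auto simp: coeff_eq_0)
    qed
  qed auto
  then show ?thesis by simp
qed

text \<open>
  Stated with bounds rather than exact degrees, since the coefficients \<open>c i\<close> may be zero, as for a
  factor \<open>[:a, b:]\<close> with \<open>b = 0\<close>.
\<close>

lemma degree_coeff_prod:
  fixes F :: "'i \<Rightarrow> ('a::comm_semiring_1) poly"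
  assumes "finite A" "\<And>i. i \<in> A \<Longrightarrow> degree (F i) \<le> e i \<and> coeff (F i) (e i) = c i"
  shows "degree (prod F A) \<le> sum e A \<and> coeff (prod F A) (sum e A) = prod c A"
  using assms
proof (induction A rule: finite_induct)
  case empty
  then show ?case by simp
next
  case (insert i A)
  then have IH: "degree (prod F A) \<le> sum e A" "coeff (prod F A) (sum e A) = prod c A"
    and i: "degree (F i) \<le> e i" "coeff (F i) (e i) = c i" by auto
  have "degree (F i * prod F A) \<le> e i + sum e A"
    using degree_mult_le[of "F i" "prod F A"] IH i by linarith
  moreover have "coeff (F i * prod F A) (e i + sum e A) = c i * prod c A"
    using coeff_mult_at_degree_bounds[of "F i" "e i" "prod F A" "sum e A"] IH i by simp
  ultimately show ?case using insert.hyps by simp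
qed

lemma degree_coeff_linear_power:
  "degree ([:a, b:] ^ k) \<le> k \<and> coeff ([:a, b:] ^ k) k = (b :: 'a :: comm_semiring_1) ^ k"
proof -
  have "degree ([:a, b:] ^ k) \<le> k"
    using degree_power_le[of "[:a, b:]" k] by (rule order_trans) (simp add: degree_pCons_le)
  moreover have "coeff ([:a, b:] ^ k) k = b ^ k"
    using degree_coeff_prod[of "{..<k}" "\<lambda>_. [:a, b:]" "\<lambda>_. 1" "\<lambda>_. b"] by simp
  ultimately show ?thesis ..
qed

text \<open>
  The coefficient of \<open>t\<^sup>k\<close> in \<open>p(x + t y)\<close> does not depend on \<open>x\<close>: only monomials of the top degree
  \<open>k\<close> reach it, and each of them must take \<open>t y\<close> from all its factors.
\<close>

lemma degree_coeff_mpoly_line: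
  assumes "total_degree p \<le> k"
  shows "degree (mpoly_line p x y) \<le> k"
    and "coeff (mpoly_line p x y) k = mpoly_eval (hom_component k p) y"
proof -
  let ?P = "\<lambda>m. \<Prod>i\<in>UNIV. [:x $ i, y $ i:] ^ Poly_Mapping.lookup m i"
  have P: "degree (?P m) \<le> monom_degree m" "coeff (?P m) (monom_degree m) = monom_value y m" for m
    using degree_coeff_prod[of UNIV "\<lambda>i. [:x $ i, y $ i:] ^ Poly_Mapping.lookup m i"
        "Poly_Mapping.lookup m" "\<lambda>i. (y $ i) ^ Poly_Mapping.lookup m i"]
      degree_coeff_linear_power
    by (auto simp: monom_degree_def monom_value_def)
  have m: "monom_degree m \<le> k" if "m \<in> Poly_Mapping.keys p" for m
    using assms that by (simp add: total_degree_le_iff)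
  have "degree ([:Poly_Mapping.lookup p m:] * ?P m) \<le> k" if "m \<in> Poly_Mapping.keys p" for m
    using degree_mult_le[of "[:Poly_Mapping.lookup p m:]" "?P m"] P(1)[of m] m[OF that] by simp
  then show "degree (mpoly_line p x y) \<le> k"
    unfolding mpoly_line_def by (intro degree_sum_le) auto
  have "coeff (?P m) k = (if monom_degree m = k then monom_value y m else 0)"
    if "m \<in> Poly_Mapping.keys p" for m
    using P[of m] m[OF that] by (auto simp: coeff_eq_0)
  then show "coeff (mpoly_line p x y) k = mpoly_eval (hom_component k p) y"
    unfolding mpoly_eval_hom_component mpoly_line_def coeff_sum
    by (intro sum.cong) auto
qed

lemma hom_component_hom_component:
  "hom_component j (hom_component j p) = hom_component j p"
  by (rule poly_mapping_eqI) (simp add: lookup_hom_component)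

lemma total_degree_hom_component_le: "total_degree (hom_component j p) \<le> j"
  by (auto simp: total_degree_le_iff in_keys_iff lookup_hom_component split: if_splits)

lemma tendsto_top_component:
  fixes p :: "(complex, 'd::finite) mpoly"
  assumes "total_degree p \<le> k"
  shows "(\<lambda>N. mpoly_eval p (of_nat (Suc N) *s z) / of_nat (Suc N) ^ k)
    \<longlonglongrightarrow> mpoly_eval (hom_component k p) z"
proof -
  have eq: "mpoly_eval p (of_nat (Suc N) *s z) / of_nat (Suc N) ^ k
    = (\<Sum>m\<in>Poly_Mapping.keys p. Poly_Mapping.lookup p m * monom_value z m
        * inverse (of_nat (Suc N)) ^ (k - monom_degree m))" for N
  proof -
    have "(of_nat (Suc N) :: complex) ^ monom_degree m / of_nat (Suc N) ^ k
        = inverse (of_nat (Suc N)) ^ (k - monom_degree m)" if "m \<in> Poly_Mapping.keys p" for m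
    proof -
      have "monom_degree m \<le> k" using assms that by (simp add: total_degree_le_iff)
      then have "(of_nat (Suc N) :: complex) ^ k
          = of_nat (Suc N) ^ monom_degree m * of_nat (Suc N) ^ (k - monom_degree m)"
        by (simp flip: power_add)
      moreover have "(of_nat (Suc N) :: complex) \<noteq> 0" by (rule of_nat_neq_0)
      ultimately show ?thesis by (simp add: power_inverse divide_simps del: of_nat_Suc)
    qed
    then show ?thesis
      unfolding mpoly_eval_superset[OF finite_keys order_refl] monom_value_scale sum_divide_distrib
      by (intro sum.cong) (auto simp flip: times_divide_eq_right simp add: mult_ac simp del: of_nat_Suc)
  qed
  have lim0: "(\<lambda>N. inverse (of_nat (Suc N)) :: complex) \<longlonglongrightarrow> 0"
    using tendsto_of_real[OF LIMSEQ_inverse_real_of_nat, where 'a = complex] by simp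
  have "(\<lambda>N. (inverse (of_nat (Suc N)) :: complex) ^ (k - monom_degree m))
      \<longlonglongrightarrow> (if monom_degree m = k then 1 else 0)"
    if "m \<in> Poly_Mapping.keys p" for m
  proof -
    have "monom_degree m \<le> k" using assms that by (simp add: total_degree_le_iff)
    then show ?thesis
      using tendsto_power[OF lim0, of "k - monom_degree m"] by (auto simp: power_0_left)
  qed
  then have "(\<lambda>N. mpoly_eval p (of_nat (Suc N) *s z) / of_nat (Suc N) ^ k)
    \<longlonglongrightarrow> (\<Sum>m\<in>Poly_Mapping.keys p. Poly_Mapping.lookup p m * monom_value z m
        * (if monom_degree m = k then 1 else 0))"
    unfolding eq by (intro tendsto_intros)
  also have "(\<Sum>m\<in>Poly_Mapping.keys p. Poly_Mapping.lookup p m * monom_value z m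
        * (if monom_degree m = k then 1 else 0)) = mpoly_eval (hom_component k p) z"
    unfolding mpoly_eval_hom_component by (intro sum.cong) auto
  finally show ?thesis .
qed

lemma base_expansion_inject:
  fixes a b :: "nat \<Rightarrow> nat"
  assumes "\<And>j. j < D \<Longrightarrow> a j < B \<and> b j < B" "(\<Sum>j<D. a j * B ^ j) = (\<Sum>j<D. b j * B ^ j)" "j < D"
  shows "a j = b j"
  using assms
proof (induction D arbitrary: a b j)
  case 0
  then show ?case by simp
next
  case (Suc D)
  have split: "(\<Sum>j<Suc D. c j * B ^ j) = c 0 + B * (\<Sum>j<D. c (Suc j) * B ^ j)" for c :: "nat \<Rightarrow> nat"
    unfolding sum.lessThan_Suc_shift sum_distrib_left by (simp add: mult_ac)
  have eq: "a 0 + B * (\<Sum>j<D. a (Suc j) * B ^ j) = b 0 + B * (\<Sum>j<D. b (Suc j) * B ^ j)"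
    using Suc.prems(2) unfolding split .
  have lt: "a 0 < B" "b 0 < B" using Suc.prems(1)[of 0] by auto
  have 0: "a 0 = b 0"
    using arg_cong[OF eq, of "\<lambda>n. n mod B"] lt by simp
  then have "(\<Sum>j<D. a (Suc j) * B ^ j) = (\<Sum>j<D. b (Suc j) * B ^ j)"
    using eq lt by auto
  then have "a (Suc j) = b (Suc j)" if "j < D" for j
    using Suc.IH[of "\<lambda>j. a (Suc j)" "\<lambda>j. b (Suc j)" j] Suc.prems(1) that by auto
  then show ?case using 0 Suc.prems(3) by (cases j) auto
qed

text \<open>
  Kronecker's substitution \<open>z\<^sub>i = t ^ (B ^ e i)\<close>, where \<open>e\<close> numbers the variables and \<open>B\<close> exceeds all
  exponents. By uniqueness of the expansion in base \<open>B\<close>, distinct monomials become distinct powers of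
  \<open>t\<close>, so a nonzero univariate polynomial results.
\<close>

lemma nonzero_mpoly_value:
  fixes p :: "('a::{idom, ring_char_0}, 'd::finite) mpoly"
  assumes "p \<noteq> 0"
  shows "\<exists>k :: 'd \<Rightarrow> nat. mpoly_eval p (\<chi> i. of_nat (k i)) \<noteq> 0"
proof -
  obtain e :: "'d \<Rightarrow> nat" where e: "bij_betw e UNIV {..<CARD('d)}"
    using ex_bij_betw_finite_nat[of "UNIV :: 'd set"] by (auto simp: atLeast0LessThan)
  define B where "B = Suc (total_degree p)"
  define \<kappa> where "\<kappa> m = (\<Sum>i\<in>UNIV. Poly_Mapping.lookup m i * B ^ e i)" for m :: "'d \<Rightarrow>\<^sub>0 nat"
  have inj: "inj_on \<kappa> (Poly_Mapping.keys p)"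
  proof
    fix m m' assume m: "m \<in> Poly_Mapping.keys p" "m' \<in> Poly_Mapping.keys p" "\<kappa> m = \<kappa> m'"
    have small: "Poly_Mapping.lookup l i < B" if "l \<in> Poly_Mapping.keys p" for l i
    proof -
      have "Poly_Mapping.lookup l i \<le> monom_degree l"
        unfolding monom_degree_def by (rule member_le_sum) auto
      also have "\<dots> \<le> total_degree p"
        using that total_degree_le_iff[of p "total_degree p"] by auto
      finally show ?thesis by (simp add: B_def)
    qed
    have \<kappa>: "\<kappa> l = (\<Sum>j<CARD('d). Poly_Mapping.lookup l (inv e j) * B ^ j)" for l
      using sum.reindex_bij_betw[OF e, of "\<lambda>j. Poly_Mapping.lookup l (inv e j) * B ^ j"] e
      by (simp add: \<kappa>_def bij_betw_def)
    have "Poly_Mapping.lookup m (inv e (e i)) = Poly_Mapping.lookup m' (inv e (e i))" for i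
      using m small e unfolding \<kappa>
      by (intro base_expansion_inject[where D = "CARD('d)" and B = B and
          a = "\<lambda>j. Poly_Mapping.lookup m (inv e j)" and
          b = "\<lambda>j. Poly_Mapping.lookup m' (inv e j)"])
        (auto simp: bij_betw_def)
    then show "m = m'"
      using e by (intro poly_mapping_eqI) (simp add: bij_betw_def)
  qed
  define P where "P = (\<Sum>m\<in>Poly_Mapping.keys p. monom (Poly_Mapping.lookup p m) (\<kappa> m))"
  obtain m0 where m0: "m0 \<in> Poly_Mapping.keys p" using assms by fastforce
  have "coeff P (\<kappa> m0) = (\<Sum>m\<in>Poly_Mapping.keys p. if m = m0 then Poly_Mapping.lookup p m else 0)"
    unfolding P_def coeff_sum using inj m0 by (intro sum.cong) (auto simp: inj_on_def)
  also have "\<dots> = Poly_Mapping.lookup p m0" using m0 by simp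
  finally have "P \<noteq> 0" using m0 by (auto simp: in_keys_iff)
  then have "finite (of_nat -` {t. poly P t = 0} :: nat set)"
    by (intro finite_vimageI) (auto simp: poly_roots_finite inj_def)
  then obtain N where N: "poly P (of_nat N) \<noteq> 0"
    using ex_new_if_finite[OF infinite_UNIV_nat] by auto
  have "monom_value (\<chi> i. of_nat (N ^ B ^ e i)) m = (of_nat N ^ \<kappa> m :: 'a)" for m
    by (simp add: monom_value_def \<kappa>_def power_sum mult.commute flip: power_mult)
  then have "mpoly_eval p (\<chi> i. of_nat (N ^ B ^ e i)) = poly P (of_nat N)"
    unfolding P_def mpoly_eval_superset[OF finite_keys order_refl] poly_sum poly_monom by simp
  then show ?thesis using N by metis
qed

lemma nonzero_real_mpoly_value: "p \<noteq> 0 \<Longrightarrow> \<exists>x. mpoly_eval p x \<noteq> 0"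
  for p :: "(real, 'd::finite) mpoly"
  using nonzero_mpoly_value by blast

lemma nonzero_complex_mpoly_value: "p \<noteq> 0 \<Longrightarrow> \<exists>x. mpoly_eval p (cvec x) \<noteq> 0"
proof -
  assume "p \<noteq> 0"
  then obtain k :: "_ \<Rightarrow> nat" where "mpoly_eval p (\<chi> i. of_nat (k i)) \<noteq> 0"
    using nonzero_mpoly_value by blast
  moreover have "(\<chi> i. of_nat (k i)) = cvec (\<chi> i. real (k i))" by (simp add: cvec_def)
  ultimately show ?thesis by metis
qed

section \<open>Nonvanishing on open sets and tubes\<close>

text \<open>
  The functions whose limits are taken below, such as \<open>p(k z) / k\<^sup>n\<close>, are polynomials too, but all that
  matters about them is a common degree bound on complex lines.
\<close>

definition polynomial_on_lines :: "nat \<Rightarrow> (complex ^ 'd \<Rightarrow> complex) \<Rightarrow> bool" where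
  "polynomial_on_lines N F \<longleftrightarrow>
     (\<forall>z v. \<exists>P. degree P \<le> N \<and> (\<forall>s. F (z + s *s v) = poly P s))"

lemma polynomial_on_lines_mpoly_eval:
  "total_degree p \<le> N \<Longrightarrow> polynomial_on_lines N (mpoly_eval p)"
  unfolding polynomial_on_lines_def
  by (metis degree_coeff_mpoly_line(1) poly_mpoly_line)

lemma polynomial_on_lines_add:
  assumes "polynomial_on_lines N F" "polynomial_on_lines N G"
  shows "polynomial_on_lines N (\<lambda>z. F z + G z)"
  unfolding polynomial_on_lines_def
proof (intro allI)
  fix z v
  obtain P Q where "degree P \<le> N" "\<forall>s. F (z + s *s v) = poly P s"
    "degree Q \<le> N" "\<forall>s. G (z + s *s v) = poly Q s"
    using assms unfolding polynomial_on_lines_def by metis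
  then show "\<exists>P. degree P \<le> N \<and> (\<forall>s. F (z + s *s v) + G (z + s *s v) = poly P s)"
    by (intro exI[of _ "P + Q"]) (auto intro: degree_add_le)
qed

lemma polynomial_on_lines_cmult:
  assumes "polynomial_on_lines N F"
  shows "polynomial_on_lines N (\<lambda>z. c * F z)"
  unfolding polynomial_on_lines_def
proof (intro allI)
  fix z v
  obtain P where "degree P \<le> N" "\<forall>s. F (z + s *s v) = poly P s"
    using assms unfolding polynomial_on_lines_def by metis
  then show "\<exists>P. degree P \<le> N \<and> (\<forall>s. c * F (z + s *s v) = poly P s)"
    by (intro exI[of _ "smult c P"]) (auto intro: order_trans[OF degree_smult_le])
qed

lemma polynomial_on_lines_scale:
  assumes "polynomial_on_lines N F"
  shows "polynomial_on_lines N (\<lambda>z. F (c *s z))"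
  unfolding polynomial_on_lines_def
proof (intro allI)
  fix z v
  obtain P where "degree P \<le> N" "\<forall>s. F (c *s z + s *s (c *s v)) = poly P s"
    using assms unfolding polynomial_on_lines_def by metis
  moreover have "c *s (z + s *s v) = c *s z + s *s (c *s v)" for s
    by (vector algebra_simps)
  ultimately show "\<exists>P. degree P \<le> N \<and> (\<forall>s. F (c *s (z + s *s v)) = poly P s)"
    by metis
qed

text \<open>
  Multivariate form of Hurwitz's theorem: on the complex line through \<open>z0\<close> and \<open>z1\<close> the functions are
  polynomials without zeros in a disc around \<open>z0\<close>, so a zero of the limit at \<open>z0\<close> would reach \<open>z1\<close>.
\<close>

lemma limit_nonvanishing:
  fixes F :: "nat \<Rightarrow> complex ^ 'd \<Rightarrow> complex"
  assumes "open \<Omega>" "\<And>k. polynomial_on_lines N (F k)" "\<And>k z. z \<in> \<Omega> \<Longrightarrow> F k z \<noteq> 0"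
    and lim: "\<And>z. (\<lambda>k. F k z) \<longlonglongrightarrow> L z" and "L z1 \<noteq> 0" "z0 \<in> \<Omega>"
  shows "L z0 \<noteq> 0"
proof
  assume L0: "L z0 = 0"
  define \<gamma> where "\<gamma> s = z0 + s *s (z1 - z0)" for s
  have "continuous_on UNIV \<gamma>"
    unfolding \<gamma>_def vector_scalar_mult_def by (intro continuous_intros)
  then have "open (\<gamma> -` \<Omega>)" using assms(1) by (rule open_vimage[rotated])
  moreover have "0 \<in> \<gamma> -` \<Omega>" using assms(6) by (simp add: \<gamma>_def)
  ultimately obtain \<rho> where \<rho>: "\<rho> > 0" "ball 0 \<rho> \<subseteq> \<gamma> -` \<Omega>" by (meson openE)
  have "\<forall>k. \<exists>P. degree P \<le> N \<and> (\<forall>s. F k (\<gamma> s) = poly P s)"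
    using assms(2) unfolding polynomial_on_lines_def \<gamma>_def by blast
  then obtain P where P: "\<And>k. degree (P k) \<le> N" "\<And>k s. F k (\<gamma> s) = poly (P k) s" by metis
  have "L (\<gamma> 1) = 0"
  proof (rule limit_of_root_free_eq_0[of P N 0 \<rho> "\<lambda>s. L (\<gamma> s)" 1])
    show "poly (P k) s \<noteq> 0" if "dist 0 s < \<rho>" for k s
    proof -
      have "\<gamma> s \<in> \<Omega>" using \<rho>(2) that by (auto simp: subset_iff)
      then show ?thesis using assms(3) P(2)[of k s] by metis
    qed
    show "(\<lambda>k. poly (P k) s) \<longlonglongrightarrow> L (\<gamma> s)" for s
      using lim[of "\<gamma> s"] by (simp only: P(2))
    show "L (\<gamma> 0) = 0" using L0 by (simp add: \<gamma>_def)
  qed (use P(1) \<rho>(1) in auto)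
  then show False using assms(5) by (simp add: \<gamma>_def)
qed

lemma tube_iff: "z \<in> tube C \<longleftrightarrow> (\<chi> i. Im (z $ i)) \<in> C"
proof
  assume "z \<in> tube C"
  then obtain x y where "z = cvec x + \<i> *s cvec y" "y \<in> C" by (auto simp: tube_def)
  moreover from this have "(\<chi> i. Im (z $ i)) = y" by (simp add: cvec_def vec_eq_iff)
  ultimately show "(\<chi> i. Im (z $ i)) \<in> C" by simp
next
  assume "(\<chi> i. Im (z $ i)) \<in> C"
  moreover have "z = cvec (\<chi> i. Re (z $ i)) + \<i> *s cvec (\<chi> i. Im (z $ i))"
    by (simp add: cvec_def vec_eq_iff complex_eq_iff)
  ultimately show "z \<in> tube C" unfolding tube_def by blast
qed

lemma open_tube:
  fixes C :: "(real ^ 'd::finite) set"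
  assumes "open C"
  shows "open (tube C)"
proof -
  have "continuous_on UNIV (\<lambda>z :: complex ^ 'd. \<chi> i. Im (z $ i))" by (intro continuous_intros)
  then have "open ((\<lambda>z :: complex ^ 'd. \<chi> i. Im (z $ i)) -` C)"
    using assms by (rule open_vimage[rotated])
  also have "(\<lambda>z :: complex ^ 'd. \<chi> i. Im (z $ i)) -` C = tube C" using tube_iff by blast
  finally show ?thesis .
qed

lemma line_in_tube:
  assumes "open_convex_cone C" "y \<in> C" "Im t > 0"
  shows "cvec x + t *s cvec y \<in> tube C"
proof -
  have "(\<chi> i. Im ((cvec x + t *s cvec y) $ i)) = Im t *\<^sub>R y"
    by (simp add: cvec_def vec_eq_iff)
  then show ?thesis using assms by (simp add: tube_iff open_convex_cone_def)
qed

lemma scale_in_tube: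
  assumes "open_convex_cone C" "z \<in> tube C" "c > 0"
  shows "of_real c *s z \<in> tube C"
proof -
  have "(\<chi> i. Im ((of_real c *s z) $ i)) = c *\<^sub>R (\<chi> i. Im (z $ i))"
    by (simp add: vec_eq_iff)
  then show ?thesis using assms by (simp add: tube_iff open_convex_cone_def)
qed

text \<open>
  Since \<open>C\<close> is a cone, all points \<open>x + t y\<close> with \<open>Im t > 0\<close> lie in the tube; and every point of the
  tube occurs among them, with \<open>t = \<i>\<close>.
\<close>

lemma stable_on_tube_iff_lines:
  assumes "open_convex_cone C"
  shows "stable_on (tube C) p \<longleftrightarrow> (\<forall>y\<in>C. \<forall>x. hurwitz_stable (mpoly_line p (cvec x) (cvec y)))"
proof
  assume "stable_on (tube C) p"
  then show "\<forall>y\<in>C. \<forall>x. hurwitz_stable (mpoly_line p (cvec x) (cvec y))"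
    using line_in_tube[OF assms] by (auto simp: stable_on_def hurwitz_stable_def poly_mpoly_line)
next
  assume R: "\<forall>y\<in>C. \<forall>x. hurwitz_stable (mpoly_line p (cvec x) (cvec y))"
  show "stable_on (tube C) p"
    unfolding stable_on_def
  proof
    fix z assume "z \<in> tube C"
    then obtain x y where "z = cvec x + \<i> *s cvec y" "y \<in> C" by (auto simp: tube_def)
    then show "mpoly_eval p z \<noteq> 0"
      using R by (auto simp: hurwitz_stable_def poly_mpoly_line dest!: bspec[of C _ y] spec[of _ x] spec[of _ \<i>])
  qed
qed

abbreviation (input) mpoly_pair :: "(real, 'd) mpoly \<Rightarrow> (real, 'd) mpoly \<Rightarrow> (complex, 'd::finite) mpoly" where
  "mpoly_pair r q \<equiv> cmpoly r + mpoly_const \<i> * cmpoly q"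

lemma mpoly_eval_pair:
  "mpoly_eval (mpoly_pair r q) z = mpoly_eval (cmpoly r) z + \<i> * mpoly_eval (cmpoly q) z"
  by (simp add: mpoly_eval_add mpoly_eval_const_times)

lemma mpoly_line_pair:
  "mpoly_line (mpoly_pair r q) (cvec x) (cvec y)
    = cpoly (mpoly_line r x y) + smult \<i> (cpoly (mpoly_line q x y))"
  unfolding poly_eq_poly_eq_iff[symmetric]
  by (rule ext) (simp add: poly_mpoly_line cpoly_mpoly_line mpoly_eval_pair)

lemma stable_on_tube_pair_iff:
  assumes "open_convex_cone C"
  shows "stable_on (tube C) (mpoly_pair r q) \<longleftrightarrow>
    (\<forall>y\<in>C. \<forall>x. stable_pair (mpoly_line r x y) (mpoly_line q x y))"
  unfolding stable_on_tube_iff_lines[OF assms] mpoly_line_pair stable_pair_def ..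

lemma stable_on_tube_reflect:
  assumes "open_convex_cone C" "stable_on (tube C) (mpoly_pair r q)" "z \<in> tube C"
  shows "norm (mpoly_eval (cmpoly r) z - \<i> * mpoly_eval (cmpoly q) z)
    \<le> norm (mpoly_eval (cmpoly r) z + \<i> * mpoly_eval (cmpoly q) z)"
proof -
  obtain x y where z: "z = cvec x + \<i> *s cvec y" "y \<in> C"
    using assms(3) by (auto simp: tube_def)
  then have "stable_pair (mpoly_line r x y) (mpoly_line q x y)"
    using assms stable_on_tube_pair_iff by blast
  from stable_pair_reflect[OF this, of \<i>] show ?thesis
    by (simp add: cpoly_mpoly_line poly_mpoly_line z)
qed

text \<open>
  Multiplying \<open>r + \<i> q\<close> by \<open>\<alpha> - \<i> \<beta>\<close> gives the stable pair \<open>A + \<i> B\<close> with \<open>A = \<alpha> r + \<beta> q\<close> and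
  \<open>B = \<alpha> q - \<beta> r\<close>. Scaling \<open>B\<close> by a positive number keeps stability, and \<open>A\<close> is the limit as this
  number tends to 0. So \<open>A\<close> has no zeros in the tube unless it is identically zero.
\<close>

lemma stable_pencil:
  assumes C: "open_convex_cone C" and st: "stable_on (tube C) (mpoly_pair r q)"
    and z1: "of_real \<alpha> * mpoly_eval (cmpoly r) z1 + of_real \<beta> * mpoly_eval (cmpoly q) z1 \<noteq> 0"
    and z: "z \<in> tube C"
  shows "of_real \<alpha> * mpoly_eval (cmpoly r) z + of_real \<beta> * mpoly_eval (cmpoly q) z \<noteq> 0"
proof -
  let ?R = "mpoly_eval (cmpoly r)" and ?Q = "mpoly_eval (cmpoly q)"
  define A B where "A z = of_real \<alpha> * ?R z + of_real \<beta> * ?Q z"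
    and "B z = of_real \<alpha> * ?Q z - of_real \<beta> * ?R z" for z
  define F where "F k z = A z + \<i> * of_real (inverse (real (Suc k))) * B z" for k z
  define N where "N = max (total_degree (cmpoly r)) (total_degree (cmpoly q))"
  have R: "polynomial_on_lines N ?R" and Q: "polynomial_on_lines N ?Q"
    by (auto intro!: polynomial_on_lines_mpoly_eval simp: N_def)
  have "A z \<noteq> 0"
  proof (rule limit_nonvanishing[of "tube C" N F A z1])
    show "open (tube C)" using C by (simp add: open_tube open_convex_cone_def)
    show "polynomial_on_lines N (F k)" for k
    proof -
      have "F k = (\<lambda>z. (of_real \<alpha> - \<i> * of_real (inverse (real (Suc k))) * of_real \<beta>) * ?R z
          + (of_real \<beta> + \<i> * of_real (inverse (real (Suc k))) * of_real \<alpha>) * ?Q z)"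
        by (simp add: F_def A_def B_def algebra_simps fun_eq_iff)
      then show ?thesis using R Q by (simp add: polynomial_on_lines_add polynomial_on_lines_cmult)
    qed
    show "F k w \<noteq> 0" if "w \<in> tube C" for k w
    proof -
      have eq: "A w + \<i> * B w = (of_real \<alpha> - \<i> * of_real \<beta>) * (?R w + \<i> * ?Q w)"
        "A w - \<i> * B w = cnj (of_real \<alpha> - \<i> * of_real \<beta>) * (?R w - \<i> * ?Q w)"
        by (simp_all add: A_def B_def algebra_simps)
      have "norm (A w - \<i> * B w) \<le> norm (A w + \<i> * B w)"
        unfolding eq norm_mult complex_mod_cnj
        using stable_on_tube_reflect[OF C st that] by (rule mult_left_mono) simp
      moreover have "of_real \<alpha> - \<i> * of_real \<beta> \<noteq> (0 :: complex)"
        using z1 by (auto simp: complex_eq_iff)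
      then have "A w + \<i> * B w \<noteq> 0"
        unfolding eq using st that by (auto simp: stable_on_def mpoly_eval_pair)
      ultimately show ?thesis
        unfolding F_def by (rule scaled_pair_ne_0) simp
    qed
    show "(\<lambda>k. F k w) \<longlonglongrightarrow> A w" for w
    proof -
      have "(\<lambda>k. F k w) \<longlonglongrightarrow> A w + \<i> * of_real 0 * B w"
        unfolding F_def by (intro tendsto_intros LIMSEQ_inverse_real_of_nat)
      then show ?thesis by simp
    qed
  qed (use z1 z in \<open>simp_all add: A_def\<close>)
  then show ?thesis by (simp add: A_def)
qed

section \<open>Leading forms of stable polynomials\<close>

text \<open>
  The tube is invariant under positive dilations, so each \<open>p(k z) / k\<^sup>n\<close> is stable, and \<open>p\<^sub>n\<close> is their
  limit.
\<close>

lemma stable_top_component: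
  assumes C: "open_convex_cone C" and st: "stable_on (tube C) p" and "p \<noteq> 0"
  shows "stable_on (tube C) (hom_component (total_degree p) p)"
  unfolding stable_on_def
proof
  fix z0 assume "z0 \<in> tube C"
  let ?n = "total_degree p"
  obtain x where x: "mpoly_eval (hom_component ?n p) (cvec x) \<noteq> 0"
    using nonzero_complex_mpoly_value hom_component_total_degree_ne_0 assms(3) by blast
  let ?F = "\<lambda>k z. inverse (of_nat (Suc k) ^ ?n) * mpoly_eval p (of_nat (Suc k) *s z)"
  show "mpoly_eval (hom_component ?n p) z0 \<noteq> 0"
  proof (rule limit_nonvanishing[of "tube C" ?n ?F _ "cvec x"])
    show "open (tube C)" using C by (simp add: open_tube open_convex_cone_def)
    show "polynomial_on_lines ?n (?F k)" for k
      by (intro polynomial_on_lines_cmult polynomial_on_lines_scale polynomial_on_lines_mpoly_eval order_refl)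
    show "?F k z \<noteq> 0" if "z \<in> tube C" for k z
      using scale_in_tube[OF C that, of "real (Suc k)"] st by (simp add: stable_on_def del: of_nat_Suc)
    show "(\<lambda>k. ?F k z) \<longlonglongrightarrow> mpoly_eval (hom_component ?n p) z" for z
      using tendsto_top_component[of p ?n z] by (simp add: divide_inverse mult.commute del: of_nat_Suc)
  qed (use x \<open>z0 \<in> tube C\<close> in auto)
qed

text \<open>
  A homogeneous polynomial satisfies \<open>u(- z) = (- 1)\<^sup>n u(z)\<close>. If \<open>t\<close> is a root of \<open>u(x + t y)\<close>, then \<open>- t\<close>
  is a root of \<open>u(- x + t y)\<close>, and neither may lie in the upper half plane. On \<open>C\<close> itself,
  \<open>u(\<i> y) = \<i>\<^sup>n u(y)\<close>, where \<open>\<i> y\<close> lies in the tube.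
\<close>

lemma stable_hom_component_real_rooted:
  assumes C: "open_convex_cone C" and st: "stable_on (tube C) (hom_component n p)" and y: "y \<in> C"
  shows "mpoly_eval (hom_component n p) (cvec y) \<noteq> 0"
    and "poly (mpoly_line (hom_component n p) (cvec x) (cvec y)) t = 0 \<Longrightarrow> t \<in> \<real>"
proof -
  let ?u = "hom_component n p"
  have "cvec 0 + \<i> *s cvec y \<in> tube C" using line_in_tube[OF C y, of \<i> 0] by simp
  moreover have "cvec 0 + \<i> *s cvec y = \<i> *s cvec y" by (simp add: cvec_def vec_eq_iff)
  ultimately have "mpoly_eval ?u (\<i> *s cvec y) \<noteq> 0" using st by (simp add: stable_on_def)
  then show "mpoly_eval ?u (cvec y) \<noteq> 0" by (simp add: mpoly_eval_hom_component_scale)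
  assume root: "poly (mpoly_line ?u (cvec x) (cvec y)) t = 0"
  have ne: "mpoly_eval ?u (cvec x + s *s cvec y) \<noteq> 0" if "Im s > 0" for s x
    using line_in_tube[OF C y that] st by (simp add: stable_on_def)
  have "cvec (- x) + (- t) *s cvec y = (- 1) *s (cvec x + t *s cvec y)"
    by (simp add: cvec_def vec_eq_iff)
  then have "mpoly_eval ?u (cvec (- x) + (- t) *s cvec y) = 0"
    using root by (simp only: mpoly_eval_hom_component_scale poly_mpoly_line mult_zero_right)
  then have "\<not> Im (- t) > 0" using ne by blast
  moreover have "\<not> Im t > 0" using ne[of t x] root by (auto simp: poly_mpoly_line)
  ultimately show "t \<in> \<real>" by (simp add: complex_is_Real_iff)
qed

lemma hyperbolic_wrt_of_stable:
  assumes C: "open_convex_cone C" and st: "stable_on (tube C) (cmpoly (hom_component n h))" and y: "y \<in> C"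
  shows "hyperbolic_wrt (hom_component n h) y"
proof -
  note eq = hom_component_cmpoly[of n h, symmetric]
  show ?thesis
    unfolding hyperbolic_wrt_def
  proof (intro conjI allI)
    show "mpoly_eval (hom_component n h) y \<noteq> 0"
      using stable_hom_component_real_rooted(1)[OF C st[unfolded eq] y] mpoly_eval_cmpoly_cvec[of "hom_component n h" y]
      by (simp add: eq)
    show "real_rooted (mpoly_line (hom_component n h) (- b) y)" for b
      unfolding real_rooted_def cpoly_mpoly_line eq
      using stable_hom_component_real_rooted(2)[OF C st[unfolded eq] y] by blast
  qed simp
qed

text \<open>
  The imaginary parts of the coefficients form a real polynomial that vanishes on all real points.
\<close>

lemma cmpoly_map_Re:
  assumes "\<And>x. mpoly_eval u (cvec x) \<in> \<real>"
  shows "cmpoly (Poly_Mapping.map Re u) = u"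
proof -
  let ?a = "Poly_Mapping.map Re u" and ?b = "Poly_Mapping.map Im u"
  have lookup: "Poly_Mapping.lookup ?a m = Re (Poly_Mapping.lookup u m)"
    "Poly_Mapping.lookup ?b m = Im (Poly_Mapping.lookup u m)" for m
    unfolding Poly_Mapping.map.rep_eq by (simp_all add: when_def)
  have u: "u = mpoly_pair ?a ?b"
    by (rule poly_mapping_eqI) (simp add: lookup_add lookup complex_eq_iff)
  have "mpoly_eval ?b x = 0" for x
  proof -
    have "mpoly_eval u (cvec x) = of_real (mpoly_eval ?a x) + \<i> * of_real (mpoly_eval ?b x)"
      by (subst u) (simp add: mpoly_eval_pair mpoly_eval_cmpoly_cvec)
    then show ?thesis using assms[of x] by (simp add: complex_is_Real_iff)
  qed
  then have "?b = 0" using nonzero_real_mpoly_value by blast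
  then have "Im (Poly_Mapping.lookup u m) = 0" for m using lookup(2)[of m] by simp
  then show ?thesis by (intro poly_mapping_eqI) (simp add: lookup complex_eq_iff)
qed

text \<open>
  With all roots of \<open>u(x + t y)\<close> real, the value \<open>u(x)\<close> at \<open>t = 0\<close> is a real multiple of the leading
  coefficient \<open>u(y)\<close>, for every real \<open>x\<close> and a fixed \<open>y\<close>. So division by \<open>u(y)\<close> makes \<open>u\<close> real.
\<close>

lemma stable_hom_component_const_phase:
  assumes C: "open_convex_cone C" and st: "stable_on (tube C) (hom_component n p)"
  obtains c h where "c \<noteq> 0" "mpoly_const c * hom_component n p = cmpoly (hom_component n h)"
proof -
  let ?u = "hom_component n p"
  obtain y where y: "y \<in> C" using C by (auto simp: open_convex_cone_def)
  have uy: "mpoly_eval ?u (cvec y) \<noteq> 0"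
    by (rule stable_hom_component_real_rooted(1)[OF C st y])
  define c where "c = inverse (mpoly_eval ?u (cvec y))"
  have "mpoly_eval (mpoly_const c * ?u) (cvec x) \<in> \<real>" for x
  proof -
    let ?T = "mpoly_line ?u (cvec x) (cvec y)"
    have T: "degree ?T \<le> n" "coeff ?T n = mpoly_eval ?u (cvec y)"
      using degree_coeff_mpoly_line[OF total_degree_hom_component_le, of n p "cvec x" "cvec y"]
      by (simp_all add: hom_component_hom_component)
    then have "degree ?T = n" using uy le_degree[of ?T n] by simp
    then have "lead_coeff ?T = mpoly_eval ?u (cvec y)" using T by simp
    moreover have "poly ?T (of_real 0) / lead_coeff ?T \<in> \<real>"
      by (rule value_over_lead_coeff_real) (rule stable_hom_component_real_rooted(2)[OF C st y])
    ultimately show ?thesis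
      unfolding mpoly_eval_const_times
      by (simp add: poly_mpoly_line c_def divide_inverse mult.commute[of "inverse _"])
  qed
  then have eq: "cmpoly (Poly_Mapping.map Re (mpoly_const c * ?u)) = mpoly_const c * ?u"
    by (rule cmpoly_map_Re)
  have "hom_component n (Poly_Mapping.map Re (mpoly_const c * ?u)) = Poly_Mapping.map Re (mpoly_const c * ?u)"
    by (rule poly_mapping_eqI)
      (simp add: lookup_hom_component Poly_Mapping.map.rep_eq when_def)
  then show thesis using that[of c] eq uy by (metis c_def nonzero_imp_inverse_nonzero)
qed

text \<open>
  The family of cones consists of the components of all points of \<open>C\<close>, each of which is a hyperbolic
  direction.
\<close>

theorem top_component_hyperbolic:
  assumes C: "open_convex_cone C" and st: "stable_on (tube C) p" and "p \<noteq> 0"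
  shows "\<exists>c h. c \<noteq> 0 \<and> mpoly_const c * hom_component (total_degree p) p = cmpoly h \<and>
    hyperbolic h \<and> (\<exists>\<K>. (\<forall>K\<in>\<K>. hyperbolicity_cone h K) \<and> C \<subseteq> closure (\<Union>\<K>))"
proof -
  let ?n = "total_degree p"
  have top: "stable_on (tube C) (hom_component ?n p)" by (rule stable_top_component[OF assms])
  obtain c h where c: "c \<noteq> 0" and h: "mpoly_const c * hom_component ?n p = cmpoly (hom_component ?n h)"
    using stable_hom_component_const_phase[OF C top] .
  let ?h = "hom_component ?n h"
  have "stable_on (tube C) (cmpoly ?h)"
    using top c unfolding h[symmetric] by (simp add: stable_on_def mpoly_eval_const_times)
  then have hyp: "hyperbolic_wrt ?h y" if "y \<in> C" for y
    using hyperbolic_wrt_of_stable[OF C _ that] by blast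
  define cc where "cc y = connected_component_set {x. mpoly_eval ?h x \<noteq> 0} y" for y
  have "\<forall>K\<in>cc ` C. hyperbolicity_cone ?h K"
    using hyp by (auto simp: hyperbolicity_cone_def cc_def)
  moreover have "y \<in> cc y" if "y \<in> C" for y
    using hyp[OF that] by (simp add: cc_def hyperbolic_wrt_def)
  then have "C \<subseteq> closure (\<Union> (cc ` C))" using closure_subset by blast
  moreover have "hyperbolic ?h" using hyp C by (auto simp: hyperbolic_def open_convex_cone_def)
  ultimately show ?thesis using c h by blast
qed

section \<open>Normalized stable polynomials\<close>

text \<open>
  As \<open>p\<^sub>n\<close> is real, \<open>q\<close> has no terms of degree \<open>n\<close>; so \<open>q \<noteq> 0\<close> excludes a constant \<open>p\<close>.
\<close>

lemma subdegree_component_pair: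
  assumes p: "p = mpoly_pair r q" and h: "hom_component (total_degree p) p = cmpoly h" and "q \<noteq> 0"
  defines "n \<equiv> total_degree p"
  shows "h = hom_component n r" "n > 0" "total_degree r \<le> n" "total_degree q \<le> n - 1"
proof -
  have lookup: "Poly_Mapping.lookup p m = of_real (Poly_Mapping.lookup r m) + \<i> * of_real (Poly_Mapping.lookup q m)" for m
    by (simp add: p lookup_add)
  have p_keys: "monom_degree m \<le> n" if "m \<in> Poly_Mapping.keys p" for m
    using that total_degree_le_iff[of p n] by (simp add: n_def)
  have keys: "m \<in> Poly_Mapping.keys p" if "m \<in> Poly_Mapping.keys r \<or> m \<in> Poly_Mapping.keys q" for m
    using that by (auto simp: in_keys_iff lookup complex_eq_iff)
  show "total_degree r \<le> n" unfolding total_degree_le_iff using keys p_keys by blast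
  have top: "Poly_Mapping.lookup h m = Poly_Mapping.lookup r m \<and> Poly_Mapping.lookup q m = 0" if "monom_degree m = n" for m
    using arg_cong[OF h, of "\<lambda>u. Poly_Mapping.lookup u m"] that
    by (simp add: lookup_hom_component n_def lookup complex_eq_iff)
  have "Poly_Mapping.lookup h m = 0" if "monom_degree m \<noteq> n" for m
    using arg_cong[OF h, of "\<lambda>u. Poly_Mapping.lookup u m"] that
    by (simp add: lookup_hom_component n_def complex_eq_iff)
  then show "h = hom_component n r" using top
    by (intro poly_mapping_eqI) (simp add: lookup_hom_component)
  have q_keys: "monom_degree m < n" if "m \<in> Poly_Mapping.keys q" for m
    using keys[of m] p_keys[of m] top[of m] that by (fastforce simp: in_keys_iff)
  then show "total_degree q \<le> n - 1" unfolding total_degree_le_iff by fastforce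
  obtain m where "m \<in> Poly_Mapping.keys q" using \<open>q \<noteq> 0\<close> by fastforce
  then show "n > 0" using q_keys by fastforce
qed

text \<open>
  The two parts of \<open>p(k z)\<close> grow like \<open>k\<^sup>n\<close> and \<open>k\<^sup>n\<^sup>-\<^sup>1\<close>. Multiplying the imaginary part by \<open>k > 0\<close>
  keeps stability, and after division by \<open>k\<^sup>n\<close> both parts have a limit. The limit does not vanish at a
  real point where \<open>r\<^sub>n\<close> does not, because its two parts are real there.
\<close>

lemma stable_top_pair:
  assumes C: "open_convex_cone C" and st: "stable_on (tube C) (mpoly_pair r q)"
    and deg: "total_degree r \<le> n" "total_degree q \<le> n - 1" "n > 0" and ne: "hom_component n r \<noteq> 0"
  shows "stable_on (tube C) (mpoly_pair (hom_component n r) (hom_component (n - 1) q))"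
  unfolding stable_on_def
proof
  fix z0 assume "z0 \<in> tube C"
  let ?R = "mpoly_eval (cmpoly r)" and ?Q = "mpoly_eval (cmpoly q)"
  let ?L = "mpoly_eval (mpoly_pair (hom_component n r) (hom_component (n - 1) q))"
  obtain x where "mpoly_eval (hom_component n r) x \<noteq> 0" using nonzero_real_mpoly_value[OF ne] by blast
  then have x: "?L (cvec x) \<noteq> 0"
    by (simp add: mpoly_eval_pair mpoly_eval_cmpoly_cvec complex_eq_iff)
  define F where "F k z = inverse (of_nat (Suc k) ^ n) * ?R (of_nat (Suc k) *s z)
    + \<i> * inverse (of_nat (Suc k) ^ (n - 1)) * ?Q (of_nat (Suc k) *s z)" for k z
  show "?L z0 \<noteq> 0"
  proof (rule limit_nonvanishing[of "tube C" n F _ "cvec x"])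
    show "open (tube C)" using C by (simp add: open_tube open_convex_cone_def)
    show "polynomial_on_lines n (F k)" for k
      unfolding F_def using deg
      by (intro polynomial_on_lines_add polynomial_on_lines_cmult polynomial_on_lines_scale
          polynomial_on_lines_mpoly_eval) (simp_all add: total_degree_cmpoly)
    show "F k z \<noteq> 0" if "z \<in> tube C" for k z
    proof -
      let ?K = "of_nat (Suc k) :: complex"
      have K: "?K *s z \<in> tube C" using scale_in_tube[OF C that, of "real (Suc k)"] by (simp del: of_nat_Suc)
      have "?R (?K *s z) + \<i> * ?Q (?K *s z) \<noteq> 0"
        using st K unfolding stable_on_def mpoly_eval_pair by blast
      then have "?R (?K *s z) + \<i> * of_real (real (Suc k)) * ?Q (?K *s z) \<noteq> 0"
        by (rule scaled_pair_ne_0[OF stable_on_tube_reflect[OF C st K]]) simp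
      moreover have "inverse (?K ^ (n - 1)) = inverse (?K ^ n) * ?K"
      proof -
        have "?K ^ n = ?K * ?K ^ (n - 1)"
          using power_Suc[of ?K "n - 1"] deg(3) by (simp only: Suc_diff_1)
        then have "inverse (?K ^ n) * ?K = inverse (?K ^ (n - 1)) * (inverse ?K * ?K)"
          by (simp only: inverse_mult_distrib mult_ac)
        also have "inverse ?K * ?K = 1" by (rule left_inverse) (rule of_nat_neq_0)
        finally show ?thesis by simp
      qed
      then have "F k z = inverse (?K ^ n) * (?R (?K *s z) + \<i> * of_real (real (Suc k)) * ?Q (?K *s z))"
        unfolding F_def by (simp only: of_real_of_nat_eq distrib_left mult_ac)
      moreover have "?K ^ n \<noteq> 0" using of_nat_neq_0 by (rule power_not_zero)
      ultimately show ?thesis by (simp only: mult_eq_0_iff inverse_nonzero_iff_nonzero) blast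
    qed
    show "(\<lambda>k. F k z) \<longlonglongrightarrow> ?L z" for z
    proof -
      have "(\<lambda>k. ?R (of_nat (Suc k) *s z) / of_nat (Suc k) ^ n
          + \<i> * (?Q (of_nat (Suc k) *s z) / of_nat (Suc k) ^ (n - 1))) \<longlonglongrightarrow> ?L z"
        unfolding mpoly_eval_add mpoly_eval_const_times hom_component_cmpoly[symmetric] using deg
        by (intro tendsto_add tendsto_mult_left tendsto_top_component) (simp_all add: total_degree_cmpoly)
      then show ?thesis by (simp add: F_def divide_inverse mult_ac del: of_nat_Suc)
    qed
  qed (use x \<open>z0 \<in> tube C\<close> in auto)
qed

text \<open>
  The limiting pair \<open>(p\<^sub>n, q\<^sub>n\<^sub>-\<^sub>1)\<close> is stable, so interlacing comes from the Hermite--Biehler theorem.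
  That \<open>q\<^sub>n\<^sub>-\<^sub>1\<close> is not zero also comes from interlacing, applied to \<open>r\<close> and \<open>q\<close> on a line in a direction
  \<open>y\<close> of \<open>C\<close>: the degree of \<open>r(x + t y)\<close> is \<open>n\<close>, so that of \<open>q(x + t y)\<close> is at least \<open>n - 1\<close>, with
  leading coefficient \<open>q\<^sub>n\<^sub>-\<^sub>1(y)\<close>.
\<close>

theorem normalized_subleading_component:
  assumes C: "open_convex_cone C" and st: "stable_on (tube C) p" and p: "p = mpoly_pair r q"
    and h: "hom_component (total_degree p) p = cmpoly h" and "q \<noteq> 0" "p \<noteq> 0"
  defines "s \<equiv> hom_component (total_degree p - 1) q"
  shows "hyperbolic s"
    and "y \<in> C \<Longrightarrow> real_rooted (mpoly_line h x y) \<and> real_rooted (mpoly_line s x y) \<and>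
      interlacing (mpoly_line h x y) (mpoly_line s x y)"
proof -
  define n where "n = total_degree p"
  note sub = subdegree_component_pair[OF p h \<open>q \<noteq> 0\<close>, folded n_def]
  have stp: "stable_on (tube C) (mpoly_pair r q)" using st p by simp
  have "stable_on (tube C) (cmpoly (hom_component n r))"
    using stable_top_component[OF C st \<open>p \<noteq> 0\<close>] h sub(1) by (simp add: n_def)
  then have hyp_h: "hyperbolic_wrt h y" if "y \<in> C" for y
    using hyperbolic_wrt_of_stable[OF C _ that] sub(1) by blast
  obtain y0 where y0: "y0 \<in> C" using C by (auto simp: open_convex_cone_def)
  then have "h \<noteq> 0" using hyp_h by (auto simp: hyperbolic_wrt_def)
  then have top: "stable_on (tube C) (mpoly_pair h s)"
    using stable_top_pair[OF C stp sub(3,4,2)] sub(1) by (simp add: s_def n_def)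
  have "s \<noteq> 0"
  proof -
    obtain x where x: "mpoly_eval q x \<noteq> 0" using nonzero_real_mpoly_value \<open>q \<noteq> 0\<close> by blast
    let ?f = "mpoly_line r x y0" and ?g = "mpoly_line q x y0"
    have "poly ?g 0 \<noteq> 0" using x by (simp add: poly_mpoly_line)
    then have g: "?g \<noteq> 0" by auto
    have "coeff ?f n \<noteq> 0"
      using degree_coeff_mpoly_line(2)[OF sub(3), of x y0] hyp_h[OF y0] sub(1) by (simp add: hyperbolic_wrt_def)
    then have f: "?f \<noteq> 0" "n \<le> degree ?f" by (auto intro: le_degree)
    have "stable_pair ?f ?g" using stp y0 stable_on_tube_pair_iff[OF C] by blast
    then have "n \<le> Suc (degree ?g)"
      using degree_le_Suc_of_interlacing[of ?f ?g] f g by (auto simp: hermite_biehler real_hurwitz_stable_def)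
    moreover have "degree ?g \<le> n - 1" by (rule degree_coeff_mpoly_line(1)[OF sub(4)])
    ultimately have "degree ?g = n - 1" using sub(2) by simp
    then have "mpoly_eval s y0 \<noteq> 0"
      using degree_coeff_mpoly_line(2)[OF sub(4), of x y0] g by (metis leading_coeff_0_iff n_def s_def)
    then show ?thesis by auto
  qed
  then obtain x1 where x1: "mpoly_eval s x1 \<noteq> 0" using nonzero_real_mpoly_value by blast
  have "stable_on (tube C) (cmpoly s)"
    unfolding stable_on_def
  proof
    fix z assume "z \<in> tube C"
    from stable_pencil[OF C top _ this, of 0 "cvec x1" 1] x1
    show "mpoly_eval (cmpoly s) z \<noteq> 0" by (simp add: mpoly_eval_cmpoly_cvec)
  qed
  then have hyp_s: "hyperbolic_wrt s y" if "y \<in> C" for y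
    using hyperbolic_wrt_of_stable[OF C _ that] unfolding s_def by blast
  then show "hyperbolic s" using y0 by (auto simp: hyperbolic_def)
  assume y: "y \<in> C"
  have "real_rooted (mpoly_line u x y)" if "hyperbolic_wrt u y" for u
    using that by (metis hyperbolic_wrt_def minus_minus)
  moreover have "stable_pair (mpoly_line h x y) (mpoly_line s x y)"
    using top y stable_on_tube_pair_iff[OF C] by blast
  ultimately show "real_rooted (mpoly_line h x y) \<and> real_rooted (mpoly_line s x y) \<and>
      interlacing (mpoly_line h x y) (mpoly_line s x y)"
    using hyp_h[OF y] hyp_s[OF y] by (auto simp: hermite_biehler)
qed

section \<open>The rational function of the real and imaginary parts\<close>

lemma Im_pos_imp_sum_ne_0:
  fixes a b :: complex
  assumes "b \<noteq> 0" "Im (a / b) > 0"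
  shows "a + \<i> * b \<noteq> 0"
proof
  assume "a + \<i> * b = 0"
  then have "a = - (\<i> * b)" by (simp only: eq_neg_iff_add_eq_0)
  then have "a / b = - \<i>" using assms(1) by (simp only: nonzero_eq_divide_eq) simp
  then show False using assms(2) by simp
qed

lemma Im_quotient_nonneg_of_reflect:
  fixes a b :: complex
  assumes "norm (a - \<i> * b) \<le> norm (a + \<i> * b)"
  shows "Im (a / b) \<ge> 0"
proof (cases "b = 0")
  case False
  define w where "w = a / b"
  have a: "a = w * b" using False by (simp add: w_def)
  have "norm ((w - \<i>) * b) \<le> norm ((w + \<i>) * b)" using assms by (simp add: a algebra_simps)
  then have "norm (w - \<i>) \<le> norm (w + \<i>)" using False by (simp add: norm_mult)
  then have "(norm (w - \<i>))\<^sup>2 \<le> (norm (w + \<i>))\<^sup>2" by (rule power_mono) simp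
  then have "Im w \<ge> 0" unfolding cmod_power2 by (simp add: power2_eq_square algebra_simps)
  then show ?thesis by (simp only: w_def)
qed simp

text \<open>
  Stability gives \<open>Im (r / q) \<ge> 0\<close> at once. If \<open>q\<close> vanished at a point of the tube, or \<open>r / q\<close> took a
  real value \<open>c\<close> there, then the member \<open>q\<close> or \<open>r - c q\<close> of the pencil would have a zero in the tube and
  hence be identically zero, against the hypotheses on \<open>q\<close> and \<open>r\<close>. This takes the place of the open mapping theorem.
\<close>

theorem Im_quotient_pos_of_stable:
  assumes C: "open_convex_cone C" and st: "stable_on (tube C) (mpoly_pair r q)"
    and "q \<noteq> 0" and np: "\<nexists>c. r = mpoly_const c * q" and z: "z \<in> tube C"
  shows "mpoly_eval (cmpoly q) z \<noteq> 0"
    and "Im (mpoly_eval (cmpoly r) z / mpoly_eval (cmpoly q) z) > 0"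
proof -
  let ?R = "mpoly_eval (cmpoly r)" and ?Q = "mpoly_eval (cmpoly q)"
  obtain x where "mpoly_eval q x \<noteq> 0" using nonzero_real_mpoly_value \<open>q \<noteq> 0\<close> by blast
  then show Q: "?Q z \<noteq> 0"
    using stable_pencil[OF C st _ z, of 0 "cvec x" 1] by (simp add: mpoly_eval_cmpoly_cvec)
  have "Im (?R z / ?Q z) \<ge> 0"
    using Im_quotient_nonneg_of_reflect stable_on_tube_reflect[OF C st z] by blast
  moreover have "Im (?R z / ?Q z) \<noteq> 0"
  proof
    assume "Im (?R z / ?Q z) = 0"
    then obtain c where "?R z / ?Q z = complex_of_real c" by (metis complex_is_Real_iff Reals_cases)
    then have c: "?R z = of_real c * ?Q z" using Q by (simp add: field_simps)
    have "r + mpoly_const (- c) * q \<noteq> 0"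
    proof
      assume "r + mpoly_const (- c) * q = 0"
      then have "Poly_Mapping.lookup (r + mpoly_const (- c) * q) m = 0" for m by simp
      then have "r = mpoly_const c * q" by (intro poly_mapping_eqI) (simp add: lookup_add)
      then show False using np by blast
    qed
    then obtain x1 where "mpoly_eval (r + mpoly_const (- c) * q) x1 \<noteq> 0"
      using nonzero_real_mpoly_value by blast
    then have "complex_of_real (mpoly_eval r x1 - c * mpoly_eval q x1) \<noteq> 0"
      unfolding of_real_eq_0_iff by (simp add: mpoly_eval_add mpoly_eval_const_times)
    then have "of_real 1 * ?R (cvec x1) + of_real (- c) * ?Q (cvec x1) \<noteq> 0"
      by (simp add: mpoly_eval_cmpoly_cvec)
    from stable_pencil[OF C st this z] c show False by simp
  qed
  ultimately show "Im (?R z / ?Q z) > 0" by simp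
qed

theorem theorem2p1:
  fixes C :: "(real ^ 'd::finite) set"
    and p :: "(complex, 'd) mpoly"
    and r q :: "(real, 'd) mpoly"
    and n :: nat
  assumes "open_convex_cone C"
    and "p \<noteq> 0"
    and "p = cmpoly r + mpoly_const \<i> * cmpoly q"
    and "n = total_degree p"
  defines "cond_i \<equiv> stable_on (tube C) p"
    and "cond_ii \<equiv> (\<forall>y\<in>C. \<forall>x. hurwitz_stable (mpoly_line p (cvec x) (cvec y)))"
    and "cond_iii \<equiv> (\<forall>y\<in>C. \<forall>x.
           real_hurwitz_stable (mpoly_line r x y) \<and> real_hurwitz_stable (mpoly_line q x y) \<and>
           interlacing (mpoly_line r x y) (mpoly_line q x y) \<and>
           positively_oriented (mpoly_line r x y) (mpoly_line q x y))"
    and "cond_iv \<equiv> (\<forall>z\<in>tube C. mpoly_eval (cmpoly q) z \<noteq> 0 \<and>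
           Im (mpoly_eval (cmpoly r) z / mpoly_eval (cmpoly q) z) > 0)"
  shows
    "((cond_i \<longleftrightarrow> cond_ii) \<and> (cond_i \<longleftrightarrow> cond_iii) \<and> (cond_iv \<longrightarrow> cond_i) \<and>
      (q \<noteq> 0 \<and> (\<nexists>c. r = mpoly_const c * q) \<longrightarrow> (cond_i \<longleftrightarrow> cond_iv))) \<and>
     (stable_on (tube C) p \<longrightarrow>
       (\<exists>c h. c \<noteq> 0 \<and> mpoly_const c * hom_component n p = cmpoly h \<and> hyperbolic h \<and>
          (\<exists>\<K>. (\<forall>K\<in>\<K>. hyperbolicity_cone h K) \<and> C \<subseteq> closure (\<Union>\<K>)))) \<and>
     (\<forall>h. stable_on (tube C) p \<and> hom_component n p = cmpoly h \<and> q \<noteq> 0 \<longrightarrow>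
       hyperbolic (hom_component (n - 1) q) \<and>
       (\<forall>x. \<forall>y\<in>C.
          real_rooted (mpoly_line h x y) \<and> real_rooted (mpoly_line (hom_component (n - 1) q) x y) \<and>
          interlacing (mpoly_line h x y) (mpoly_line (hom_component (n - 1) q) x y)))"
proof -
  note C = assms(1) and p = assms(3) and n = assms(4)
  have ii: "cond_i \<longleftrightarrow> cond_ii"
    unfolding cond_i_def cond_ii_def by (rule stable_on_tube_iff_lines[OF C])
  have iii: "cond_i \<longleftrightarrow> cond_iii"
    unfolding cond_i_def cond_iii_def p stable_on_tube_pair_iff[OF C] hermite_biehler ..
  have iv: "cond_iv \<longrightarrow> cond_i"
    unfolding cond_i_def cond_iv_def stable_on_def p mpoly_eval_pair
    using Im_pos_imp_sum_ne_0 by blast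
  have iv': "q \<noteq> 0 \<and> (\<nexists>c. r = mpoly_const c * q) \<longrightarrow> (cond_i \<longleftrightarrow> cond_iv)"
    using iv Im_quotient_pos_of_stable[OF C, of r q] p unfolding cond_i_def cond_iv_def by blast
  show ?thesis
    using ii iii iv iv' top_component_hyperbolic[OF C _ assms(2)]
      normalized_subleading_component[OF C _ p _ _ assms(2)]
    unfolding n by blast
qed

end
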